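(* Let $m,n\ge 1$ and let $\Psi:\mathbb{Z}^m\to\mathbb{R}_{\ge 0}$ be a non-negative function. Then the $mn$-dimensional Lebesgue measure of each of the sets $\mathcal{S}^\times_{m,n}(\Psi)$ and $\mathcal{D}^\times_{m,n}(\Psi)$ is either $0$ or $1$.
   Context: For $\mathbf{y}=(y_1,\dots,y_n)\in\mathbb{R}^n$ let $\Pi(\mathbf{y}):=\prod_{i=1}^n|y_i|$. Points $\mathbf{X}\in[0,1]^{mn}$ are regarded as real $m\times n$ matrices, and $\mathbf{q}\in\mathbb{Z}^m$ as a row vector, so $\mathbf{q}\mathbf{X}\in\mathbb{R}^n$. Let $\mathcal{S}^\times_{m,n}(\Psi)$ be the set of $\mathbf{X}\in[0,1]^{mn}$ such that $\Pi(\mathbf{q}\mathbf{X}+\mathbf{p})<\Psi(\mathbf{q})$ holds for infinitely many $(\mathbf{p},\mathbf{q})\in\mathbb{Z}^n\times(\mathbb{Z}^m\setminus\{\mathbf{0}\})$. Let $\mathcal{D}^\times_{m,n}(\Psi)$ be the set of $\mathbf{X}\in[0,1]^{mn}$ such that this inequality holds for infinitely many such $(\mathbf{p},\mathbf{q})$, $\mathbf{p}=(p_1,\dots,p_n)$, satisfying in addition $\gcd(p_i,q_1,\dots,q_m)=1$ for all $1\le i\le n$. *)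

theory Defs
  imports "HOL-Analysis.Analysis"
begin

(* A real m x n matrix has type real^'n^'m: X $ i $ j is the entry in row i and column j. *)

definition unit_cube :: "(real^'n^'m) set" where
  "unit_cube = {X. \<forall>i j. 0 \<le> X $ i $ j \<and> X $ i $ j \<le> 1}"

definition real_vec :: "int^'k \<Rightarrow> real^'k" where
  "real_vec v = (\<chi> i. real_of_int (v $ i))"

definition height_prod :: "real^'n \<Rightarrow> real" where
  "height_prod y = (\<Prod>i\<in>UNIV. \<bar>y $ i\<bar>)"

definition mult_solution ::
  "(int^'m \<Rightarrow> real) \<Rightarrow> real^'n^'m \<Rightarrow> int^'n \<Rightarrow> int^'m \<Rightarrow> bool" where
  "mult_solution \<Psi> X p q \<longleftrightarrow> q \<noteq> 0 \<and> height_prod (real_vec q v* X + real_vec p) < \<Psi> q"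

definition S_mult :: "(int^'m \<Rightarrow> real) \<Rightarrow> (real^'n^'m) set" where
  "S_mult \<Psi> = {X \<in> unit_cube. infinite {(p, q). mult_solution \<Psi> X p q}}"

definition D_mult :: "(int^'m \<Rightarrow> real) \<Rightarrow> (real^'n^'m) set" where
  "D_mult \<Psi> = {X \<in> unit_cube. infinite {(p, q). mult_solution \<Psi> X p q \<and>
      (\<forall>i. Gcd (insert (p $ i) (range (\<lambda>k. q $ k))) = 1)}}"

end

theory Submission
  imports Defs
begin

text \<open>Let \<open>E\<close> be the set of all real matrices for which infinitely many \<open>q\<close> admit a solution \<open>p\<close>. Up to
  a null set (some entry of \<open>q X\<close> an integer) this is the same as infinitely many pairs
  \<open>(p, q)\<close>. Fixing all columns but one turns the condition into an approximation problem for a single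
  linear form, \<open>W q (q \<bullet> t + p)\<close>, where \<open>W q\<close> cuts out an interval around \<open>0\<close> of a radius
  depending arbitrarily on \<open>q\<close>. The zero-one laws of Cassels and Gallagher hold for such problems:
  the constant in the approximation does not matter by a density argument, so the limsup sets are
  almost invariant under expanding maps of the torus, or else under translations by \<open>1 / l\<close> for all
  primes \<open>l\<close>. Hence every fibre of \<open>E\<close> along a column is null or co-null, so by Fubini \<open>E\<close> is almost
  invariant under each translation of a column, thus under all translations.\<close>

subsection \<open>Lebesgue density and almost invariant sets\<close>

text \<open>A weak form of Lebesgue's density theorem, by Vitali covering: a bounded piece
  \<open>S\<close> of positive measure would be covered, up to a null set, by disjoint balls inside
  an open \<open>T\<close> barely larger than \<open>S\<close>, and \<open>E\<close> fills at most
  the proportion \<open>\<theta>\<close> of each ball.\<close>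

lemma negligible_if_density_bounded:
  fixes E :: "'a::euclidean_space set"
  assumes E: "E \<in> sets lebesgue" and "\<theta> < 1"
    and dens: "\<And>x e. x \<in> E \<Longrightarrow> e > 0 \<Longrightarrow>
      \<exists>r>0. r < e \<and> measure lebesgue (E \<inter> ball x r) \<le> \<theta> * measure lebesgue (ball x r)"
  shows "negligible E"
proof -
  let ?\<mu> = "measure lebesgue"
  have "negligible (E \<inter> ball 0 (real n))" for n
  proof (rule ccontr)
    define S where "S = E \<inter> ball 0 (real n)"
    assume "\<not> negligible (E \<inter> ball 0 (real n))"
    moreover have Sm: "S \<in> lmeasurable"
      unfolding S_def by (intro fmeasurable_Int_fmeasurable[of "ball 0 (real n)" lebesgue E, simplified Int_commute] E) auto
    ultimately have s: "?\<mu> S > 0"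
      using S_def negligible_iff_measure zero_less_measure_iff by blast
    \<comment> \<open>With this slack \<open>\<theta> * (?\<mu> S + e) < ?\<mu> S\<close>, which is
      the contradiction aimed at.\<close>
    define e where "e = ?\<mu> S * (1 - \<theta>)"
    have e: "e > 0" using s \<open>\<theta> < 1\<close> by (simp add: e_def)
    obtain T where T: "open T" "S \<subseteq> T" "T - S \<in> lmeasurable" "emeasure lebesgue (T - S) < ennreal e"
      using sets_lebesgue_outer_open[OF _ e, of S] Sm by blast
    have TS: "T = S \<union> (T - S)" using T by blast
    have Tm: "T \<in> lmeasurable" using TS T(3) Sm fmeasurable.Un by metis
    have "?\<mu> (T - S) < e"
      using T(3,4) e by (simp add: emeasure_eq_measure2 ennreal_less_iff)
    then have muT: "?\<mu> T < ?\<mu> S + e"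
      using measurable_measure_Diff[OF Tm _ T(2)] Sm by fastforce
    have "0 \<le> \<theta>"
    proof -
      obtain x where "x \<in> E" using s S_def by fastforce
      then obtain r where r: "r > 0" "?\<mu> (E \<inter> ball x r) \<le> \<theta> * ?\<mu> (ball x r)"
        using dens[of x 1] by auto
      then have "0 \<le> \<theta> * ?\<mu> (ball x r)" using measure_nonneg order_trans by blast
      then show ?thesis using content_ball_pos[OF r(1), of x] by (simp add: zero_le_mult_iff)
    qed
    let ?K = "{(x,d). 0 < d \<and> ball x d \<subseteq> T \<and> ?\<mu> (E \<inter> ball x d) \<le> \<theta> * ?\<mu> (ball x d)}"
    obtain C where C: "countable C" "C \<subseteq> ?K"
      and pwC: "pairwise (\<lambda>i j. disjnt (ball (fst i) (snd i)) (ball (fst j) (snd j))) C"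
      and negC: "negligible (S - (\<Union>i \<in> C. ball (fst i) (snd i)))"
    proof (rule Vitali_covering_theorem_balls [of S ?K fst snd])
      fix x and d :: real assume x: "x \<in> S" and "d > 0"
      obtain k where "k > 0" and k: "ball x k \<subseteq> T"
        using x T by (meson open_contains_ball subsetD)
      obtain r where "r > 0" "r < min d k" "?\<mu> (E \<inter> ball x r) \<le> \<theta> * ?\<mu> (ball x r)"
        using dens[of x "min d k"] x \<open>d > 0\<close> \<open>k > 0\<close> S_def by auto
      then show "\<exists>i. i \<in> ?K \<and> x \<in> ball (fst i) (snd i) \<and> snd i < d"
        using k by (intro exI[of _ "(x,r)"]) auto
    qed
    let ?U = "\<lambda>i. E \<inter> ball (fst i) (snd i)"
    have Um: "?U i \<in> lmeasurable" for i
      using E by (metis fmeasurable_Int_fmeasurable inf_commute lmeasurable_ball)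
    \<comment> \<open>The bound is uniform over finite subfamilies, so it passes to the countable
      family \<open>C\<close>.\<close>
    have bound: "?\<mu> (\<Union>i\<in>I. ?U i) \<le> \<theta> * ?\<mu> T" if "I \<subseteq> C" "finite I" for I
    proof -
      have "?\<mu> (\<Union>i\<in>I. ?U i) \<le> (\<Sum>i\<in>I. ?\<mu> (?U i))"
        using that Um by (intro measure_UNION_le) auto
      also have "\<dots> \<le> (\<Sum>i\<in>I. \<theta> * ?\<mu> (ball (fst i) (snd i)))"
        by (rule sum_mono) (use that C(2) in force)
      also have "\<dots> = \<theta> * ?\<mu> (\<Union>i\<in>I. ball (fst i) (snd i))"
        using that pwC by (subst measure_UNION') (auto simp: sum_distrib_left elim: pairwise_mono)
      also have "\<dots> \<le> \<theta> * ?\<mu> T"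
        using that C(2) Tm \<open>0 \<le> \<theta>\<close>
        by (intro mult_left_mono measure_mono_fmeasurable) force+
      finally show ?thesis .
    qed
    have UC: "(\<Union>i\<in>C. ?U i) \<in> lmeasurable" "?\<mu> (\<Union>i\<in>C. ?U i) \<le> \<theta> * ?\<mu> T"
      using fmeasurable_UN_bound[OF C(1) Um bound] measure_UN_bound[OF C(1) Um bound] by auto
    have "S \<subseteq> (S - (\<Union>i \<in> C. ball (fst i) (snd i))) \<union> (\<Union>i\<in>C. ?U i)"
      using S_def by auto
    then have "?\<mu> S \<le> ?\<mu> ((S - (\<Union>i \<in> C. ball (fst i) (snd i))) \<union> (\<Union>i\<in>C. ?U i))"
      using fmeasurableD[OF Sm] fmeasurable.Un[OF negligible_imp_measurable[OF negC] UC(1)]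
      by (rule measure_mono_fmeasurable)
    also have "\<dots> \<le> 0 + ?\<mu> (\<Union>i\<in>C. ?U i)"
      using measure_Un_le[OF negligible_imp_sets[OF negC] fmeasurableD[OF UC(1)]] negligible_imp_measure0[OF negC]
      by linarith
    also have "\<dots> \<le> \<theta> * ?\<mu> T" using UC(2) by linarith
    also have "\<theta> * ?\<mu> T \<le> \<theta> * (?\<mu> S + e)"
      using muT \<open>0 \<le> \<theta>\<close> by (intro mult_left_mono) auto
    also have "\<dots> = \<theta> * ?\<mu> S + \<theta> * e" by (simp add: algebra_simps)
    also have "\<dots> < \<theta> * ?\<mu> S + e" using \<open>\<theta> < 1\<close> e by simp
    also have "\<dots> = ?\<mu> S" by (simp add: e_def algebra_simps)
    finally show False by simp
  qed
  then have "negligible (\<Union>n. E \<inter> ball 0 (real n))"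
    by (intro negligible_countable_Union) auto
  moreover have "E \<subseteq> (\<Union>n. E \<inter> ball 0 (real n))"
    using reals_Archimedean2 by auto
  ultimately show ?thesis by (rule negligible_subset)
qed

lemma density_point:
  fixes E :: "'a::euclidean_space set"
  assumes "E \<in> sets lebesgue" "\<not> negligible E" "\<theta> < 1"
  shows "\<exists>x\<in>E. \<exists>e>0. \<forall>r. 0 < r \<longrightarrow> r < e \<longrightarrow>
    \<theta> * measure lebesgue (ball x r) < measure lebesgue (E \<inter> ball x r)"
proof (rule ccontr)
  assume no: "\<not> ?thesis"
  have "negligible E"
  proof (rule negligible_if_density_bounded[OF assms(1,3)])
    fix x and e :: real assume "x \<in> E" "e > 0"
    with no show "\<exists>r>0. r < e \<and> measure lebesgue (E \<inter> ball x r) \<le> \<theta> * measure lebesgue (ball x r)"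
      by (meson not_le)
  qed
  with assms(2) show False by simp
qed

lemma sets_lebesgue_Compl: "E \<in> sets lebesgue \<Longrightarrow> - E \<in> sets lebesgue"
  using sets.compl_sets[of E lebesgue] by (simp add: Compl_eq_Diff_UNIV)

lemma lmeasurable_Int_ball: "E \<in> sets lebesgue \<Longrightarrow> E \<inter> ball x r \<in> lmeasurable"
  by (metis fmeasurable_Int_fmeasurable inf_commute lmeasurable_ball)

lemma measure_Compl_Int_ball:
  assumes "E \<in> sets lebesgue"
  shows "measure lebesgue (- E \<inter> ball x r) = measure lebesgue (ball x r) - measure lebesgue (E \<inter> ball x r)"
proof -
  have "- E \<inter> ball x r = ball x r - E \<inter> ball x r" by auto
  then show ?thesis
    using measurable_measure_Diff[of "ball x r" lebesgue "E \<inter> ball x r"] lmeasurable_Int_ball[OF assms] by simp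
qed

text \<open>A density point of the complement is moved close to a density point of the set.\<close>

lemma negligible_or_conegligible_translations:
  fixes E :: "'a::euclidean_space set"
  assumes E: "E \<in> sets lebesgue"
    and dense: "\<And>w e. e > 0 \<Longrightarrow> \<exists>v. dist v w < e \<and> negligible {z. z \<notin> E \<and> z + v \<in> E}"
  shows "negligible E \<or> negligible (- E)"
proof (rule ccontr)
  let ?\<mu> = "measure lebesgue"
  assume "\<not> (negligible E \<or> negligible (- E))"
  then have n: "\<not> negligible E" "\<not> negligible (- E)" by auto
  \<comment> \<open>A ball of half the radius has measure \<open>2 * k * \<beta>\<close>, while each
    of the two density points allows an exceptional set of measure below \<open>k * \<beta>\<close>;
    together these cannot fill the half ball.\<close>
  define k where "k = (1/2) ^ DIM('a) / (2::real)"
  have k: "k > 0" by (simp add: k_def)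
  obtain y e1 where y: "e1 > 0" "\<And>r. 0 < r \<Longrightarrow> r < e1 \<Longrightarrow> (1 - k) * ?\<mu> (ball y r) < ?\<mu> (E \<inter> ball y r)"
    using density_point[OF E n(1), of "1 - k"] k by fastforce
  obtain x e2 where x: "e2 > 0" "\<And>r. 0 < r \<Longrightarrow> r < e2 \<Longrightarrow> (1 - k) * ?\<mu> (ball x r) < ?\<mu> (- E \<inter> ball x r)"
    using density_point[OF sets_lebesgue_Compl[OF E] n(2), of "1 - k"] k by fastforce
  define r where "r = min e1 e2 / 2"
  have r: "0 < r" "r < e1" "r < e2" using x y by (auto simp: r_def)
  define \<beta> where "\<beta> = ?\<mu> (ball (0::'a) r)"
  have b: "?\<mu> (ball z r) = \<beta>" for z :: 'a
    unfolding \<beta>_def using r by (simp add: content_ball_conv_unit_ball[of r])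
  have half: "?\<mu> (ball z (r/2)) = 2 * k * \<beta>" for z :: 'a
    unfolding \<beta>_def k_def using r content_ball_conv_unit_ball[of "r/2" z] content_ball_conv_unit_ball[of r "0::'a"]
    by (simp add: power_divide)
  have yE: "?\<mu> (- E \<inter> ball y r) < k * \<beta>"
    using y(2)[of r] r by (simp add: measure_Compl_Int_ball[OF E] b algebra_simps)
  have xE: "?\<mu> (E \<inter> ball x r) < k * \<beta>"
    using x(2)[of r] r by (simp add: measure_Compl_Int_ball[OF E] b algebra_simps)
  obtain v where v: "dist v (y - x) < r/2" "negligible {z. z \<notin> E \<and> z + v \<in> E}"
    using dense[of "r/2" "y - x"] r by auto
  let ?B = "ball y (r/2)"
  have sub: "z - v \<in> ball x r" if "z \<in> ?B" for z
  proof -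
    have "norm (x - (z - v)) \<le> norm (y - z) + norm (v - (y - x))"
      using norm_triangle_ineq[of "y - z" "v - (y - x)"] by (simp add: algebra_simps)
    moreover have "norm (y - z) < r/2" using that by (simp add: dist_norm)
    moreover have "norm (v - (y - x)) < r/2" using v(1) by (simp add: dist_norm)
    ultimately have "norm (x - (z - v)) < r" by linarith
    then show ?thesis by (simp add: dist_norm)
  qed
  \<comment> \<open>Translation by \<open>- v\<close> takes \<open>E \<inter> ?B\<close> into the
    ball about \<open>x\<close>; by almost invariance the points that leave \<open>E\<close> on the
    way form a null set.\<close>
  have "(+) (-v) ` (E \<inter> ?B) \<subseteq> (E \<inter> ball x r) \<union> {z. z \<notin> E \<and> z + v \<in> E}"
    using sub by (auto simp: algebra_simps)
  then have "?\<mu> ((+) (-v) ` (E \<inter> ?B)) \<le> ?\<mu> ((E \<inter> ball x r) \<union> {z. z \<notin> E \<and> z + v \<in> E})"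
    by (rule measure_mono_fmeasurable[OF _ fmeasurableD[OF measurable_translation[OF lmeasurable_Int_ball[OF E]]]
      fmeasurable.Un[OF lmeasurable_Int_ball[OF E] negligible_imp_measurable[OF v(2)]]])
  also have "\<dots> \<le> ?\<mu> (E \<inter> ball x r) + ?\<mu> {z. z \<notin> E \<and> z + v \<in> E}"
    by (rule measure_Un_le[OF fmeasurableD[OF lmeasurable_Int_ball[OF E]] negligible_imp_sets[OF v(2)]])
  finally have 1: "?\<mu> (E \<inter> ?B) < k * \<beta>"
    using xE negligible_imp_measure0[OF v(2)] by (simp only: measure_translation) 
  have "?\<mu> (- E \<inter> ?B) \<le> ?\<mu> (- E \<inter> ball y r)"
    using r by (intro measure_mono_fmeasurable[OF _ fmeasurableD[OF lmeasurable_Int_ball[OF sets_lebesgue_Compl[OF E]]]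
      lmeasurable_Int_ball[OF sets_lebesgue_Compl[OF E]]]) auto
  with yE 1 half[of y] measure_Compl_Int_ball[OF E, of y "r/2"] show False by simp
qed

section \<open>Integer-periodic sets and expanding affine maps\<close>

lemma real_vec_nth [simp]: "real_vec z $ i = of_int (z $ i)"
  by (simp add: real_vec_def)

lemma periodic_shift:
  assumes per: "\<And>x z. x \<in> E \<Longrightarrow> x + real_vec z \<in> E"
  shows "x + real_vec z \<in> E \<longleftrightarrow> x \<in> E"
proof -
  have "x + real_vec z + real_vec (- z) = x" by (simp add: vec_eq_iff)
  then show ?thesis using per by metis
qed

text \<open>The part of \<open>F\<close> in the unit cell has positive measure, and an integer
  translation moves it into any ball of radius \<open>CARD('m) + 1\<close>; this makes
  \<open>\<kappa>\<close> uniform in the centre.\<close>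

lemma periodic_positive_in_balls:
  fixes F :: "(real^'m) set"
  assumes F: "F \<in> sets lebesgue" and per: "\<And>x z. x \<in> F \<Longrightarrow> x + real_vec z \<in> F"
    and "\<not> negligible F"
  obtains R \<kappa> where "R > 0" "\<kappa> > 0" "\<And>x. measure lebesgue (F \<inter> ball x R) \<ge> \<kappa>"
proof -
  define C where "C = F \<inter> {x. \<forall>i. 0 \<le> x $ i \<and> x $ i \<le> 1}"
  have cb: "{x::real^'m. \<forall>i. 0 \<le> x $ i \<and> x $ i \<le> 1} = cbox 0 1"
    by (simp add: set_eq_iff mem_box_cart)
  have Cm: "C \<in> lmeasurable"
    unfolding C_def cb using F by (metis fmeasurable_Int_fmeasurable inf_commute lmeasurable_cbox)
  have floor: "x \<in> (+) (real_vec (\<chi> i. \<lfloor>x $ i\<rfloor>)) ` C" if "x \<in> F" for x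
  proof (rule image_eqI)
    let ?z = "(\<chi> i. \<lfloor>x $ i\<rfloor>)"
    show "x = real_vec ?z + (x - real_vec ?z)" by simp
    have "x - real_vec ?z \<in> F"
      using periodic_shift[of F "x - real_vec ?z" ?z] per that by auto
    moreover have "0 \<le> x $ i - \<lfloor>x $ i\<rfloor> \<and> x $ i - \<lfloor>x $ i\<rfloor> \<le> 1" for i
      using floor_correct[of "x $ i"] by linarith
    ultimately show "x - real_vec ?z \<in> C" by (simp add: C_def)
  qed
  have "\<not> negligible C"
  proof
    assume "negligible C"
    then have "negligible (\<Union>z. (+) (real_vec z) ` C)"
      by (intro negligible_countable_Union negligible_translation) (auto simp: negligible_translation)
    moreover have "F \<subseteq> (\<Union>z. (+) (real_vec z) ` C)" using floor by blast
    ultimately show False using assms(3) negligible_subset by blast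
  qed
  then have pos: "measure lebesgue C > 0"
    using Cm negligible_iff_measure zero_less_measure_iff by blast
  show ?thesis
  proof (rule that[of "real CARD('m) + 1" "measure lebesgue C"])
    fix x :: "real^'m"
    let ?z = "\<chi> i. \<lfloor>x $ i\<rfloor>"
    have "(+) (real_vec ?z) ` C \<subseteq> F \<inter> ball x (real CARD('m) + 1)"
    proof (intro subsetI IntI)
      fix y assume "y \<in> (+) (real_vec ?z) ` C"
      then obtain c where c: "c \<in> C" "y = c + real_vec ?z" by auto
      then show "y \<in> F" using per by (auto simp: C_def)
      have "\<bar>(x - y) $ i\<bar> \<le> 1" for i
      proof -
        have "0 \<le> c $ i" "c $ i \<le> 1" using c(1) by (auto simp: C_def)
        moreover have "y $ i = c $ i + \<lfloor>x $ i\<rfloor>" using c(2) by simp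
        moreover have "(x - y) $ i = x $ i - y $ i" by simp
        ultimately show ?thesis using floor_correct[of "x $ i"] by linarith
      qed
      then have "(\<Sum>i\<in>UNIV. \<bar>(x - y) $ i\<bar>) \<le> real CARD('m)"
        using sum_mono[of UNIV "\<lambda>i. \<bar>(x - y) $ i\<bar>" "\<lambda>_. 1"] by simp
      then have "norm (x - y) \<le> real CARD('m)"
        using norm_le_l1_cart[of "x - y"] by linarith
      then show "y \<in> ball x (real CARD('m) + 1)" by (simp add: dist_norm)
    qed
    then have "measure lebesgue ((+) (real_vec ?z) ` C) \<le> measure lebesgue (F \<inter> ball x (real CARD('m) + 1))"
      using F Cm by (intro measure_mono_fmeasurable lmeasurable_Int_ball fmeasurableD[OF measurable_translation]) auto
    then show "measure lebesgue C \<le> measure lebesgue (F \<inter> ball x (real CARD('m) + 1))"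
      by (simp only: measure_translation)
  qed (use pos in auto)
qed

text \<open>Iterating the map blows a tiny ball about a point of \<open>E\<close> up to a ball of
  radius \<open>R\<close>, where by periodicity the complement keeps measure at least
  \<open>\<kappa>\<close>. Hence around each of its points \<open>E\<close> has density bounded away
  from 1 at arbitrarily small scales.\<close>

lemma negligible_or_conegligible_expanding:
  fixes E :: "(real^'m) set"
  assumes E: "E \<in> sets lebesgue" and per: "\<And>x z. x \<in> E \<Longrightarrow> x + real_vec z \<in> E"
    and "l > 1" and T: "\<And>x. x \<in> E \<Longrightarrow> l *\<^sub>R x + w \<in> E"
  shows "negligible E \<or> negligible (- E)"
proof (rule ccontr)
  let ?\<mu> = "measure lebesgue"
  assume "\<not> (negligible E \<or> negligible (- E))"
  then have n: "\<not> negligible E" "\<not> negligible (- E)" by auto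
  have perC: "x + real_vec z \<in> - E" if "x \<in> - E" for x z
    using that periodic_shift[of E] per by blast
  obtain R \<kappa> where R: "R > 0" "\<kappa> > 0" "\<And>x. ?\<mu> (- E \<inter> ball x R) \<ge> \<kappa>"
    using periodic_positive_in_balls[OF sets_lebesgue_Compl[OF E] perC n(2)] by metis
  define \<beta> where "\<beta> = ?\<mu> (ball (0::real^'m) R)"
  have b: "?\<mu> (ball z R) = \<beta>" for z :: "real^'m"
    unfolding \<beta>_def using R by (simp add: content_ball_conv_unit_ball[of R])
  have "\<beta> > 0" unfolding \<beta>_def using R by (simp add: content_ball_pos)
  define \<theta> where "\<theta> = 1 - \<kappa> / \<beta>"
  have \<theta>: "\<theta> < 1" using R \<open>\<beta> > 0\<close> by (simp add: \<theta>_def)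
  have up: "?\<mu> (E \<inter> ball z R) \<le> \<theta> * \<beta>" for z
  proof -
    have "\<theta> * \<beta> = \<beta> - \<kappa>" using \<open>\<beta> > 0\<close> by (simp add: \<theta>_def left_diff_distrib)
    then show ?thesis using R(3)[of z] by (simp add: measure_Compl_Int_ball[OF E] b)
  qed
  have iter: "\<exists>u. \<forall>x\<in>E. (l ^ k) *\<^sub>R x + u \<in> E" for k
  proof (induction k)
    case 0 then show ?case by (intro exI[of _ 0]) auto
  next
    case (Suc k)
    then obtain u where u: "\<forall>x\<in>E. (l ^ k) *\<^sub>R x + u \<in> E" by blast
    have "(l ^ Suc k) *\<^sub>R x + (l *\<^sub>R u + w) \<in> E" if "x \<in> E" for x
      using T[of "(l ^ k) *\<^sub>R x + u"] u that by (simp add: algebra_simps)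
    then show ?case by blast
  qed
  have "negligible E"
  proof (rule negligible_if_density_bounded[OF E \<theta>])
    fix x :: "real^'m" and e :: real assume "x \<in> E" "e > 0"
    obtain k where k: "R / e < l ^ k" using real_arch_pow[OF \<open>l > 1\<close>] by blast
    obtain u where u: "\<forall>x\<in>E. (l ^ k) *\<^sub>R x + u \<in> E" using iter by blast
    define L where "L = l ^ k"
    have L: "L > 0" using \<open>l > 1\<close> by (simp add: L_def)
    define r where "r = R / L"
    have r: "r > 0" "r < e" using R L k \<open>e > 0\<close> by (auto simp: r_def L_def field_simps)
    have scale: "?\<mu> ((\<lambda>y. L *\<^sub>R y + u) ` S) = L ^ DIM(real^'m) * ?\<mu> S" for S :: "(real^'m) set"
      using measure_lebesgue_affine[of L u S] L by simp
    have img: "(\<lambda>y. L *\<^sub>R y + u) ` (ball x r) = ball (L *\<^sub>R x + u) R"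
    proof -
      have "(\<lambda>y. L *\<^sub>R y + u) ` (ball x r) = (+) u ` ((*\<^sub>R) L ` ball x r)"
        by (simp add: image_image add.commute)
      also have "\<dots> = ball (L *\<^sub>R x + u) (L * r)"
        using L by (simp add: ball_scale image_add_ball)
      finally show ?thesis using L by (simp add: r_def)
    qed
    have sub: "(\<lambda>y. L *\<^sub>R y + u) ` (E \<inter> ball x r) \<subseteq> E \<inter> ball (L *\<^sub>R x + u) R"
      using u img by (auto simp: L_def)
    \<comment> \<open>Lebesgue measurability of the image comes from writing it as a preimage under
      the inverse affine map.\<close>
    have "(\<lambda>y. L *\<^sub>R y + u) ` (E \<inter> ball x r) = (\<lambda>y. (1/L) *\<^sub>R y + (-(1/L) *\<^sub>R u)) -` (E \<inter> ball x r)"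
    proof (intro set_eqI iffI)
      fix y assume "y \<in> (\<lambda>y. (1/L) *\<^sub>R y + (-(1/L) *\<^sub>R u)) -` (E \<inter> ball x r)"
      then show "y \<in> (\<lambda>y. L *\<^sub>R y + u) ` (E \<inter> ball x r)"
        using L by (intro image_eqI[of _ _ "(1/L) *\<^sub>R y + (-(1/L) *\<^sub>R u)"]) (auto simp: algebra_simps)
    qed (use L in \<open>auto simp: algebra_simps\<close>)
    moreover have "(\<lambda>y. (1/L) *\<^sub>R y + (-(1/L) *\<^sub>R u)) \<in> lebesgue \<rightarrow>\<^sub>M lebesgue"
    proof -
      have "(\<lambda>y. -(1/L) *\<^sub>R u + (\<Sum>j\<in>Basis. ((1/L) * (y \<bullet> j)) *\<^sub>R j)) = (\<lambda>y. (1/L) *\<^sub>R y + (-(1/L) *\<^sub>R u))"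
        unfolding scaleR_scaleR[symmetric] scaleR_sum_right[symmetric]
        by (auto simp: euclidean_representation ac_simps)
      then show ?thesis
        using lebesgue_affine_measurable[of "\<lambda>_. 1/L" "-(1/L) *\<^sub>R u"] L by simp
    qed
    ultimately have meas: "(\<lambda>y. L *\<^sub>R y + u) ` (E \<inter> ball x r) \<in> sets lebesgue"
      using measurable_sets[of _ lebesgue lebesgue "E \<inter> ball x r"] fmeasurableD[OF lmeasurable_Int_ball[OF E]] by simp
    have "L ^ DIM(real^'m) * ?\<mu> (E \<inter> ball x r) = ?\<mu> ((\<lambda>y. L *\<^sub>R y + u) ` (E \<inter> ball x r))"
      using scale by simp
    also have "\<dots> \<le> ?\<mu> (E \<inter> ball (L *\<^sub>R x + u) R)"
      using sub E meas by (intro measure_mono_fmeasurable lmeasurable_Int_ball) auto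
    also have "\<dots> \<le> \<theta> * ?\<mu> (ball (L *\<^sub>R x + u) R)" using up b by simp
    also have "\<dots> = L ^ DIM(real^'m) * (\<theta> * ?\<mu> (ball x r))"
      using scale[of "ball x r"] img by simp
    finally have "?\<mu> (E \<inter> ball x r) \<le> \<theta> * ?\<mu> (ball x r)"
      using L by simp
    then show "\<exists>r>0. r < e \<and> ?\<mu> (E \<inter> ball x r) \<le> \<theta> * ?\<mu> (ball x r)" using r by blast
  qed
  then show False using n by simp
qed

subsection \<open>Approximation by one linear form\<close>

lemma finite_iff_to_nat_bounded: "finite S \<longleftrightarrow> (\<exists>n. \<forall>i\<in>S. to_nat i < n)"
proof -
  have "finite S \<longleftrightarrow> finite (to_nat ` S)"
    by (metis finite_imageD finite_imageI inj_on_subset inj_to_nat top_greatest)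
  then show ?thesis by (simp add: finite_nat_set_iff_bounded)
qed

text \<open>Along the enumeration \<open>to_nat\<close> the set is a countable limsup.\<close>

lemma infinitely_often_borel:
  fixes U :: "'i::countable \<Rightarrow> 'a::topological_space set"
  assumes "\<And>i. U i \<in> sets borel"
  shows "{t. infinite {i\<in>Q. t \<in> U i}} \<in> sets borel"
proof -
  have "{t. infinite {i\<in>Q. t \<in> U i}} = (\<Inter>n. \<Union>i\<in>{i\<in>Q. n \<le> to_nat i}. U i)"
    by (auto simp: finite_iff_to_nat_bounded not_less)
  also have "\<dots> \<in> sets borel"
    using assms by (intro sets.countable_INT' sets.countable_UN') auto
  finally show ?thesis .
qed

lemma norm_real_vec_ge: "\<bar>real_of_int (q $ i)\<bar> \<le> norm (real_vec q)"
  using component_le_norm_cart[of "real_vec q" i] by simp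

lemma real_vec_eq_0_iff [simp]: "real_vec q = 0 \<longleftrightarrow> q = 0"
  by (simp add: vec_eq_iff)

lemma finite_norm_real_vec_le: "finite {q :: int^'m. norm (real_vec q) \<le> K}"
proof -
  have "finite {q :: int^'m. \<forall>i. q $ i \<in> {- \<lceil>K\<rceil> .. \<lceil>K\<rceil>}}"
  proof (rule finite_subset)
    show "{q :: int^'m. \<forall>i. q $ i \<in> {- \<lceil>K\<rceil> .. \<lceil>K\<rceil>}} \<subseteq> vec_lambda ` (\<Pi>\<^sub>E i\<in>UNIV. {- \<lceil>K\<rceil> .. \<lceil>K\<rceil>})"
      by (auto intro!: image_eqI[of _ _ "\<lambda>i. _ $ i"])
  qed (intro finite_imageI finite_PiE, auto)
  moreover have "{q :: int^'m. norm (real_vec q) \<le> K} \<subseteq> {q. \<forall>i. q $ i \<in> {- \<lceil>K\<rceil> .. \<lceil>K\<rceil>}}"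
  proof clarify
    fix q :: "int^'m" and i assume "norm (real_vec q) \<le> K"
    then have "\<bar>real_of_int (q $ i)\<bar> \<le> K" using norm_real_vec_ge order_trans by blast
    then show "q $ i \<in> {- \<lceil>K\<rceil> .. \<lceil>K\<rceil>}" by (auto simp: abs_le_iff) linarith+
  qed
  ultimately show ?thesis by (rule rev_finite_subset)
qed

lemma inner_real_vec: "real_vec q \<bullet> real_vec z = of_int (\<Sum>i\<in>UNIV. q $ i * z $ i)"
  by (simp add: inner_vec_def)

text \<open>\<open>R p q\<close> says which integers \<open>p\<close> may serve as numerators for
  \<open>q\<close>. Each \<open>W q\<close> describes an open symmetric interval about 0, possibly
  empty or the whole line. In \<open>gap\<close>, division by the norm of \<open>q\<close> turns the
  spacing of numerators into the spacing of the hyperplanes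
  \<open>real_vec q \<bullet> t + of_int p = 0\<close>, which has to tend to 0.\<close>

locale linear_form_approximation =
  fixes R :: "int \<Rightarrow> int^'m::finite \<Rightarrow> bool" and W :: "int^'m \<Rightarrow> real \<Rightarrow> bool"
  assumes R_shift: "R p q \<Longrightarrow> R (p + (\<Sum>i\<in>UNIV. q $ i * z $ i)) q"
    and gap: "e > 0 \<Longrightarrow> finite {q. \<not> (\<forall>x::real. \<exists>p. R p q \<and> \<bar>x + of_int p\<bar> \<le> e * norm (real_vec q))}"
    and W_open: "open {y. W q y}"
    and W_mono: "W q x \<Longrightarrow> \<bar>y\<bar> \<le> \<bar>x\<bar> \<Longrightarrow> W q y"
begin

text \<open>As \<open>c\<close> multiplies the argument of \<open>W\<close>, a smaller positive
  \<open>c\<close> gives a larger set.\<close>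

definition near :: "real \<Rightarrow> int^'m \<Rightarrow> (real^'m) set" where
  "near c q = {t. \<exists>p. R p q \<and> W q (c * (real_vec q \<bullet> t + of_int p))}"

definition often_near :: "(int^'m) set \<Rightarrow> real \<Rightarrow> (real^'m) set" where
  "often_near Q c = {t. infinite {q\<in>Q. t \<in> near c q}}"

lemma open_near: "open (near c q)"
proof -
  have "near c q = (\<Union>p\<in>{p. R p q}. (\<lambda>t. c * (real_vec q \<bullet> t + of_int p)) -` {y. W q y})"
    by (auto simp: near_def)
  moreover have "open ((\<lambda>t::real^'m. c * (real_vec q \<bullet> t + of_int p)) -` {y. W q y})" for p
    by (rule open_vimage[OF W_open]) (intro continuous_intros)
  ultimately show ?thesis by (metis (no_types, lifting) open_UN)
qed

lemma often_near_borel: "often_near Q c \<in> sets borel"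
  unfolding often_near_def by (rule infinitely_often_borel) (simp add: open_near)

lemma often_near_lebesgue: "often_near Q c \<in> sets lebesgue"
  using often_near_borel by (simp add: sets_completionI_sets)

lemma often_near_mono:
  assumes "Q \<subseteq> Q'" "0 \<le> c'" "c' \<le> c"
  shows "often_near Q c \<subseteq> often_near Q' c'"
proof -
  have "near c q \<subseteq> near c' q" for q
  proof
    fix t assume "t \<in> near c q"
    then obtain p where p: "R p q" "W q (c * (real_vec q \<bullet> t + of_int p))" by (auto simp: near_def)
    have "\<bar>c' * (real_vec q \<bullet> t + of_int p)\<bar> \<le> \<bar>c * (real_vec q \<bullet> t + of_int p)\<bar>"
      using assms by (auto simp: abs_mult intro!: mult_right_mono)
    then show "t \<in> near c' q" using p W_mono by (auto simp: near_def)
  qed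
  then have "{q\<in>Q. t \<in> near c q} \<subseteq> {q\<in>Q'. t \<in> near c' q}" for t using assms(1) by auto
  then show ?thesis unfolding often_near_def by (auto dest: finite_subset)
qed

lemma near_shift: "t \<in> near c q \<Longrightarrow> t + real_vec z \<in> near c q"
proof -
  assume "t \<in> near c q"
  then obtain p where p: "R p q" "W q (c * (real_vec q \<bullet> t + of_int p))" by (auto simp: near_def)
  have "R (p + (\<Sum>i\<in>UNIV. q $ i * (- z) $ i)) q" using R_shift[OF p(1)] .
  moreover have "real_vec q \<bullet> (t + real_vec z) + of_int (p + (\<Sum>i\<in>UNIV. q $ i * (- z) $ i))
      = real_vec q \<bullet> t + of_int p"
    by (simp add: inner_add_right inner_real_vec sum_negf)
  ultimately show ?thesis using p(2) unfolding near_def by (metis (mono_tags, lifting) mem_Collect_eq)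
qed

lemma often_near_shift: "t \<in> often_near Q c \<Longrightarrow> t + real_vec z \<in> often_near Q c"
proof -
  assume "t \<in> often_near Q c"
  moreover have "{q\<in>Q. t \<in> near c q} \<subseteq> {q\<in>Q. t + real_vec z \<in> near c q}" by (auto intro: near_shift)
  ultimately show ?thesis unfolding often_near_def by (auto dest: finite_subset)
qed

text \<open>Cassels' scaling lemma. Choosing \<open>p\<close> closest to \<open>- q \<bullet> t\<close> (this is where \<open>gap\<close> enters) makes the
  hyperplane \<open>q \<bullet> s + p = 0\<close> so close to \<open>t\<close> that a fixed proportion of a small ball about \<open>t\<close> is
  near it with the better constant \<open>c'\<close>.\<close>

lemma negligible_often_near_diff:
  assumes c: "0 < c" "c \<le> c'"
  shows "negligible (often_near Q c - often_near Q c')"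
proof -
  \<comment> \<open>\<open>N n\<close> collects the points that meet the condition with
    \<open>c\<close> infinitely often, but with \<open>c'\<close> for no \<open>q\<close> of index
    at least \<open>n\<close>; these sets exhaust the difference.\<close>
  define V where "V n = (\<Union>q\<in>{q\<in>Q. n \<le> to_nat q}. near c' q)" for n
  define N where "N n = often_near Q c - V n" for n
  have "negligible (N n)" for n
  proof (rule negligible_if_density_bounded)
    define \<theta> where "\<theta> = c / c'"
    have \<theta>: "0 < \<theta>" "\<theta> \<le> 1" using c by (auto simp: \<theta>_def)
    have "open (V n)" unfolding V_def by (intro open_UN) (simp add: open_near)
    then show Nm: "N n \<in> sets lebesgue"
      unfolding N_def by (intro sets.Diff often_near_lebesgue) auto
    show "1 - (\<theta> / 2) ^ DIM(real^'m) < 1" using \<theta> by simp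
    fix t and e :: real assume t: "t \<in> N n" and "e > 0"
    let ?g = "{q. \<not> (\<forall>x::real. \<exists>p. R p q \<and> \<bar>x + of_int p\<bar> \<le> e/4 * norm (real_vec q))}"
    \<comment> \<open>Only finitely many \<open>q\<close> are discarded: those of index below
      \<open>n\<close>, those violating the gap bound for \<open>e/4\<close>, and 0.\<close>
    have "finite ({q. to_nat q < n} \<union> ?g \<union> {0})"
      using \<open>e > 0\<close> gap[of "e/4"] finite_iff_to_nat_bounded[of "{q :: int^'m. to_nat q < n}"] by auto
    moreover have "infinite {q\<in>Q. t \<in> near c q}" using t by (simp add: N_def often_near_def)
    ultimately have "infinite ({q\<in>Q. t \<in> near c q} - ({q. to_nat q < n} \<union> ?g \<union> {0}))"
      by (rule Diff_infinite_finite)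
    then obtain q where q: "q \<in> Q" "t \<in> near c q" "n \<le> to_nat q" "q \<noteq> 0"
        "\<And>x::real. \<exists>p. R p q \<and> \<bar>x + of_int p\<bar> \<le> e/4 * norm (real_vec q)"
    proof -
      from \<open>infinite (_ - _)\<close> have "{q\<in>Q. t \<in> near c q} - ({q. to_nat q < n} \<union> ?g \<union> {0}) \<noteq> {}"
        by (metis finite.emptyI)
      then obtain q where "q \<in> {q\<in>Q. t \<in> near c q} - ({q. to_nat q < n} \<union> ?g \<union> {0})"
        unfolding ex_in_conv[symmetric] ..
      then show thesis by (intro that[of q]) (simp_all add: not_less)
    qed
    define z where "z = real_vec q \<bullet> t"
    define h where "h = norm (real_vec q)"
    have h: "h > 0" using q(4) by (simp add: h_def)
    \<comment> \<open>\<open>p0\<close> from the gap bound gives closeness and \<open>p1\<close>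
      from \<open>near\<close> gives \<open>W\<close>; the one with the smaller value of the form
      has both properties.\<close>
    obtain p where p: "R p q" "W q (c * (z + of_int p))" "\<bar>z + of_int p\<bar> \<le> e/4 * h"
    proof -
      obtain p0 where p0: "R p0 q" "\<bar>z + of_int p0\<bar> \<le> e/4 * h" using q(5) h_def by blast
      obtain p1 where p1: "R p1 q" "W q (c * (z + of_int p1))" using q(2) by (auto simp: near_def z_def)
      show thesis
      proof (cases "\<bar>z + of_int p1\<bar> \<le> \<bar>z + of_int p0\<bar>")
        case True then show ?thesis using that[of p1] p0 p1 by linarith
      next
        case False
        then have "\<bar>c * (z + of_int p0)\<bar> \<le> \<bar>c * (z + of_int p1)\<bar>"
          using c by (simp add: abs_mult)
        then show ?thesis using that[of p0] p0 W_mono[OF p1(2)] by blast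
      qed
    qed
    define y where "y = \<bar>z + of_int p\<bar>"
    have "\<not> W q (c' * (z + of_int p))"
      using t q p(1) by (auto simp: N_def V_def near_def z_def)
    then have "z + of_int p \<noteq> 0" using p(2) by auto
    then have y: "y > 0" by (simp add: y_def)
    \<comment> \<open>The hyperplane lies at distance \<open>y / h\<close> from \<open>t\<close>.
      Doubling this leaves room for a ball centred on the hyperplane, and the bound with
      \<open>e/4\<close> keeps \<open>r < e\<close>.\<close>
    define r where "r = 2 * y / h"
    have r: "r > 0" "r < e"
    proof -
      show "r > 0" using y h by (simp add: r_def)
      have "2 * y \<le> e / 2 * h" using p(3) by (simp add: y_def)
      also have "\<dots> < e * h" using \<open>e > 0\<close> h by simp
      finally show "r < e" using h by (simp add: r_def field_simps)
    qed
    \<comment> \<open>The foot of the perpendicular from \<open>t\<close> to the hyperplane given by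
      \<open>q\<close> and \<open>p\<close>.\<close>
    define a where "a = t - ((z + of_int p) / h^2) *\<^sub>R real_vec q"
    have hh: "real_vec q \<bullet> real_vec q = h^2" by (simp add: h_def power2_norm_eq_inner)
    have a0: "real_vec q \<bullet> a + of_int p = 0"
      using h by (simp add: a_def inner_diff_right hh z_def[symmetric])
    have ta: "dist t a = y / h"
      using h by (simp add: a_def dist_norm y_def h_def[symmetric] power2_eq_square abs_mult)
    have rh: "\<theta> / 2 * r = \<theta> * y / h" by (simp add: r_def)
    have sub: "ball a (\<theta> / 2 * r) \<subseteq> ball t r - N n"
    proof
      fix s assume s: "s \<in> ball a (\<theta> / 2 * r)"
      then have as: "dist a s < \<theta> * y / h" by (simp only: rh mem_ball)
      also have "\<dots> \<le> y / h" using \<theta> y h by (simp add: divide_right_mono)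
      finally have "dist t s < r" using ta dist_triangle[of t s a] by (simp add: r_def)
      moreover have "s \<in> near c' q"
      proof -
        have "real_vec q \<bullet> s + of_int p = real_vec q \<bullet> (s - a)"
          using a0 by (simp add: inner_diff_right)
        then have "\<bar>real_vec q \<bullet> s + of_int p\<bar> \<le> h * norm (s - a)"
          using Cauchy_Schwarz_ineq2[of "real_vec q" "s - a"] by (simp add: h_def)
        also have "\<dots> \<le> h * (\<theta> * y / h)"
          using as h by (intro mult_left_mono) (auto simp: dist_norm norm_minus_commute)
        also have "\<dots> = c * y / c'" using h by (simp add: \<theta>_def)
        finally have "c' * \<bar>real_vec q \<bullet> s + of_int p\<bar> \<le> c * y" using c by (simp add: field_simps)
        then have "\<bar>c' * (real_vec q \<bullet> s + of_int p)\<bar> \<le> \<bar>c * (z + of_int p)\<bar>"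
          using c by (simp add: abs_mult y_def)
        then show ?thesis using W_mono[OF p(2)] p(1) by (auto simp: near_def)
      qed
      ultimately show "s \<in> ball t r - N n" using q(1,3) by (auto simp: N_def V_def)
    qed
    have "N n \<inter> ball t r \<subseteq> ball t r - ball a (\<theta> / 2 * r)" using sub by auto
    then have "measure lebesgue (N n \<inter> ball t r) \<le> measure lebesgue (ball t r - ball a (\<theta> / 2 * r))"
      using Nm by (intro measure_mono_fmeasurable fmeasurableD[OF lmeasurable_Int_ball] fmeasurable.Diff) auto
    also have "\<dots> = measure lebesgue (ball t r) - measure lebesgue (ball a (\<theta> / 2 * r))"
      using sub by (intro measurable_measure_Diff) auto
    also have "\<dots> = (1 - (\<theta> / 2) ^ DIM(real^'m)) * measure lebesgue (ball t r)"
    proof -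
      have "measure lebesgue (ball a (\<theta> / 2 * r)) = (\<theta> / 2) ^ DIM(real^'m) * measure lebesgue (ball t r)"
        using content_ball_conv_unit_ball[of "\<theta> / 2 * r" a] content_ball_conv_unit_ball[of r t] r \<theta>
        by (simp add: power_mult_distrib power_divide)
      then show ?thesis by (simp add: left_diff_distrib)
    qed
    finally show "\<exists>r>0. r < e \<and> measure lebesgue (N n \<inter> ball t r) \<le> (1 - (\<theta> / 2) ^ DIM(real^'m)) * measure lebesgue (ball t r)"
      using r by blast
  qed
  then have "negligible (\<Union>n. N n)" by (intro negligible_countable_Union) auto
  moreover have "often_near Q c - often_near Q c' \<subseteq> (\<Union>n. N n)"
  proof
    fix t assume t: "t \<in> often_near Q c - often_near Q c'"
    then obtain n where "\<forall>q\<in>{q\<in>Q. t \<in> near c' q}. to_nat q < n"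
      by (auto simp: often_near_def finite_iff_to_nat_bounded)
    then have "t \<in> N n" using t by (auto simp: N_def V_def)
    then show "t \<in> (\<Union>n. N n)" by blast
  qed
  ultimately show ?thesis by (rule negligible_subset)
qed

text \<open>The map \<open>t \<mapsto> l t + w\<close> costs only a factor \<open>l\<close> in the constant, which the scaling lemma absorbs.\<close>

lemma zero_one_of_multiplication:
  fixes l :: int
  assumes l: "l > 1"
    and T: "\<And>p q. q \<in> Q \<Longrightarrow> R p q \<Longrightarrow> \<exists>p'. R p' q \<and> real_of_int p' = of_int l * of_int p - real_vec q \<bullet> w"
  shows "negligible (often_near Q 1) \<or> negligible (- often_near Q 1)"
proof -
  \<comment> \<open>The map sends this union into itself, each application passing from exponent
    \<open>k\<close> to \<open>Suc k\<close>; the union exceeds \<open>often_near Q 1\<close> only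
    by a null set.\<close>
  define B where "B = (\<Union>k. often_near Q ((1 / of_int l) ^ k))"
  have Bm: "B \<in> sets lebesgue" unfolding B_def by (intro sets.countable_UN') (auto simp: often_near_lebesgue)
  have B: "negligible B \<or> negligible (- B)"
  proof (rule negligible_or_conegligible_expanding[OF Bm])
    show "x + real_vec z \<in> B" if "x \<in> B" for x z
      using that often_near_shift unfolding B_def by blast
    show "real_of_int l > 1" using l by simp
    fix x assume "x \<in> B"
    then obtain k where k: "x \<in> often_near Q ((1 / of_int l) ^ k)" by (auto simp: B_def)
    let ?c = "(1 / real_of_int l) ^ k"
    have "of_int l *\<^sub>R x + w \<in> near (?c / of_int l) q" if q: "q \<in> Q" "x \<in> near ?c q" for q
    proof -
      obtain p where p: "R p q" "W q (?c * (real_vec q \<bullet> x + of_int p))" using q(2) by (auto simp: near_def)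
      obtain p' where p': "R p' q" "real_of_int p' = of_int l * of_int p - real_vec q \<bullet> w"
        using T[OF q(1) p(1)] by blast
      \<comment> \<open>The choice of \<open>p'\<close> makes the form at the image point exactly
        \<open>l\<close> times the form at \<open>x\<close>.\<close>
      have "?c / of_int l * (real_vec q \<bullet> (of_int l *\<^sub>R x + w) + of_int p') = ?c * (real_vec q \<bullet> x + of_int p)"
        using l by (simp add: p'(2) inner_add_right field_simps)
      then show ?thesis using p p'(1) by (auto simp: near_def)
    qed
    then have "{q\<in>Q. x \<in> near ?c q} \<subseteq> {q\<in>Q. of_int l *\<^sub>R x + w \<in> near (?c / of_int l) q}" by auto
    then have "of_int l *\<^sub>R x + w \<in> often_near Q ((1 / of_int l) ^ Suc k)"
      using k unfolding often_near_def by (auto dest: finite_subset)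
    then show "of_int l *\<^sub>R x + w \<in> B" unfolding B_def by blast
  qed
  have "often_near Q 1 \<subseteq> B" unfolding B_def by (rule order_trans[OF _ UN_upper[of 0]]) auto
  moreover have "negligible (B - often_near Q 1)"
  proof -
    have "negligible (often_near Q ((1 / of_int l) ^ k) - often_near Q 1)" for k
      using l by (intro negligible_often_near_diff) (auto intro!: power_le_one)
    then have "negligible (\<Union>k. often_near Q ((1 / of_int l) ^ k) - often_near Q 1)"
      by (intro negligible_countable_Union) auto
    then show ?thesis unfolding B_def by (rule negligible_subset) auto
  qed
  moreover have "- often_near Q 1 = - B \<union> (B - often_near Q 1)" using calculation(1) by auto
  ultimately show ?thesis using B negligible_subset negligible_Un by metis
qed

end

text \<open>With every integer allowed as numerator the gaps are at most 1, and doubling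
  \<open>t\<close> just doubles \<open>p\<close>, so the doubling map serves as the expanding
  map.\<close>

lemma zero_one_linear_form:
  fixes W :: "int^'m::finite \<Rightarrow> real \<Rightarrow> bool"
  assumes "\<And>q. open {y. W q y}" "\<And>q x y. W q x \<Longrightarrow> \<bar>y\<bar> \<le> \<bar>x\<bar> \<Longrightarrow> W q y"
  defines "E \<equiv> {t. infinite {q. q \<noteq> 0 \<and> (\<exists>p. W q (real_vec q \<bullet> t + of_int p))}}"
  shows "negligible E \<or> negligible (- E)"
proof -
  interpret linear_form_approximation "\<lambda>_ _. True" W
  proof
    fix e :: real assume "e > 0"
    show "finite {q :: int^'m. \<not> (\<forall>x::real. \<exists>p. True \<and> \<bar>x + of_int p\<bar> \<le> e * norm (real_vec q))}"
    proof (rule finite_subset[OF _ finite_norm_real_vec_le[of "1 / e"]], rule subsetI)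
      fix q :: "int^'m"
      assume "q \<in> {q. \<not> (\<forall>x::real. \<exists>p. True \<and> \<bar>x + of_int p\<bar> \<le> e * norm (real_vec q))}"
      then obtain x :: real where x: "\<And>p. \<not> \<bar>x + of_int p\<bar> \<le> e * norm (real_vec q)" by auto
      have "\<bar>x + of_int (- \<lfloor>x\<rfloor>)\<bar> \<le> 1" using floor_correct[of x] by linarith
      with x[of "- \<lfloor>x\<rfloor>"] have "e * norm (real_vec q) \<le> 1" by linarith
      then show "q \<in> {q. norm (real_vec q) \<le> 1 / e}" using \<open>e > 0\<close> by (simp add: field_simps)
    qed
  qed (use assms in auto)
  have "E = often_near (- {0}) 1" by (simp add: E_def often_near_def near_def)
  moreover have "negligible (often_near (- {0}) 1) \<or> negligible (- often_near (- {0}) 1)"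
  proof (rule zero_one_of_multiplication[where l=2 and w=0])
    fix p :: int and q :: "int^'m"
    show "\<exists>p'. True \<and> real_of_int p' = of_int 2 * of_int p - real_vec q \<bullet> 0"
      by (intro exI[of _ "2 * p"]) simp
  qed simp
  ultimately show ?thesis by simp
qed

section \<open>Numerators coprime to the content of \<open>q\<close>\<close>

definition content_int :: "int^'m \<Rightarrow> int" where
  "content_int q = Gcd (range (\<lambda>k. q $ k))"

lemma content_int_dvd: "content_int q dvd q $ k"
  by (simp add: content_int_def)

lemma content_int_nonneg: "content_int q \<ge> 0"
  by (simp add: content_int_def)

lemma content_int_eq_0_iff: "content_int q = 0 \<longleftrightarrow> q = 0"
  by (auto simp: content_int_def vec_eq_iff)

lemma content_int_le_norm: 
  assumes "q \<noteq> 0"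
  shows "real_of_int (content_int q) \<le> norm (real_vec q)"
proof -
  obtain k where "q $ k \<noteq> 0" using assms by (auto simp: vec_eq_iff)
  then have "content_int q \<le> \<bar>q $ k\<bar>"
    using content_int_dvd[of q k] by (simp add: zdvd_imp_le)
  then show ?thesis using norm_real_vec_ge[of q k] by linarith
qed

lemma coprime_mult_add_left_iff: "coprime (d * k + a) d \<longleftrightarrow> coprime a (d :: int)"
proof -
  have "gcd d (k * d + a) = gcd d a" by (rule gcd_add_mult)
  then show ?thesis by (simp add: coprime_iff_gcd_eq_1 gcd.commute mult.commute)
qed

text \<open>Otherwise every prime power dividing \<open>d\<close> would divide \<open>M!\<close>.\<close>

lemma large_prime_power_dvd:
  fixes d :: nat
  assumes "d > fact M"
  obtains l e where "prime l" "e > 0" "l ^ e > M" "l ^ e dvd d" "coprime (d div l ^ e) l"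
proof -
  have d: "d \<noteq> 0" using assms by simp
  have "\<not> d dvd fact M" using assms dvd_imp_le[of d "fact M"] by auto
  then obtain l where l: "prime l" "multiplicity l (fact M) < multiplicity l d"
    using multiplicity_le_imp_dvd[of d "fact M"] d by (meson not_le)
  define e where "e = multiplicity l d"
  have "\<not> l ^ e dvd fact M"
    using l multiplicity_geI[of "fact M" l e] not_prime_unit[of l] unfolding e_def by fastforce
  then have "l ^ e > M"
    using l(1) dvd_fact[of "l ^ e" M] prime_gt_0_nat[of l] by (metis One_nat_def Suc_leI not_le zero_less_power)
  moreover have "coprime (d div l ^ e) l"
  proof -
    have "\<not> l dvd d div l ^ e"
      using multiplicity_decompose[of d l] l(1) d not_prime_unit unfolding e_def by blast
    then show ?thesis using l(1) prime_imp_coprime coprime_commute by blast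
  qed
  ultimately show ?thesis using that[of l e] l by (auto simp: e_def multiplicity_dvd)
qed

text \<open>If \<open>d = b N\<close> with \<open>N\<close> a power of a prime \<open>l\<close> and \<open>b\<close> prime to \<open>l\<close>, then \<open>b v + N\<close> is prime to
  \<open>d\<close> whenever \<open>l\<close> does not divide \<open>v\<close>; so the gaps are at most \<open>2 d / N\<close>.\<close>

lemma coprime_in_short_intervals:
  assumes "e > 0"
  obtains K where "\<And>d x. d > K \<Longrightarrow> \<exists>p. coprime p d \<and> \<bar>(x::real) + of_int p\<bar> \<le> e * of_int d"
proof -
  \<comment> \<open>Every \<open>N > M\<close> satisfies \<open>2 / e < N\<close>, so that
    \<open>b = d / N\<close> is below \<open>e * d\<close>.\<close>
  define M where "M = nat \<lceil>2 / e\<rceil>"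
  have "\<exists>p. coprime p d \<and> \<bar>x + of_int p\<bar> \<le> e * of_int d" if dK: "d > int (fact M)" for d and x :: real
  proof -
    have "nat d > fact M" using dK by linarith
    then obtain l k where l: "prime l" "k > 0" "l ^ k > M" "l ^ k dvd nat d" "coprime (nat d div l ^ k) l"
      by (rule large_prime_power_dvd)
    define N where "N = int l ^ k"
    define b where "b = int (nat d div l ^ k)"
    have d: "d = b * N"
    proof -
      have "nat d = (nat d div l ^ k) * l ^ k" using l(4) by simp
      then have "int (nat d) = b * N" unfolding b_def N_def by (metis of_nat_mult of_nat_power)
      then show ?thesis using dK by simp
    qed
    have "N > 0" using l(1) by (simp add: N_def prime_gt_0_nat)
    then have b: "b > 0" using d dK by (smt (verit) zero_less_mult_pos2 of_nat_0_le_iff)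
    have cb: "coprime b (int l)" unfolding b_def using l(5) by simp
    \<comment> \<open>\<open>- x\<close> lies between \<open>b * u + N\<close> and
      \<open>b * (u + 1) + N\<close>; of the neighbours \<open>u\<close> and \<open>u + 1\<close> at
      least one is not divisible by \<open>l\<close>.\<close>
    define u where "u = \<lfloor>(- x - of_int N) / of_int b\<rfloor>"
    have u: "of_int u * of_int b \<le> - x - of_int N" "- x - of_int N < (of_int u + 1) * of_int b"
      using floor_correct[of "(- x - of_int N) / of_int b"] b unfolding u_def[symmetric]
      by (simp_all add: field_simps)
    have "\<exists>v. (v = u \<or> v = u + 1) \<and> \<not> int l dvd v"
    proof -
      have "\<not> (int l dvd u \<and> int l dvd u + 1)"
      proof
        assume "int l dvd u \<and> int l dvd u + 1"
        then have "int l dvd 1" using dvd_add_right_iff by blast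
        then show False using l(1) by (simp add: not_prime_1 prime_gt_Suc_0_nat) 
      qed
      then show ?thesis by auto
    qed
    then obtain v where v: "v = u \<or> v = u + 1" "\<not> int l dvd v" by blast
    define p where "p = b * v + N"
    have "coprime v (int l)" using v(2) l(1) prime_imp_coprime[of "int l" v] by (simp add: coprime_commute)
    then have "coprime (b * v) (int l)" using cb by simp
    moreover have "b * v + N = int l * int l ^ (k - 1) + b * v"
      using l(2) by (simp add: N_def power_eq_if)
    ultimately have "coprime (b * v + N) (int l)" by (simp only: coprime_mult_add_left_iff)
    moreover have "coprime (b * v + N) b"
    proof -
      have "coprime N b" using cb unfolding N_def by (simp add: coprime_commute)
      then show ?thesis by (simp add: coprime_mult_add_left_iff)
    qed
    ultimately have "coprime p d" unfolding p_def d N_def by simp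
    moreover have "\<bar>x + of_int p\<bar> \<le> of_int b"
    proof -
      have "real_of_int p = of_int u * of_int b + of_int N \<or> real_of_int p = (of_int u + 1) * of_int b + of_int N"
        using v(1) by (auto simp: p_def algebra_simps)
      then show ?thesis using u by (auto simp: algebra_simps abs_le_iff)
    qed
    moreover have "real_of_int b \<le> e * of_int d"
    proof -
      have "2 / e \<le> real M" unfolding M_def by linarith
      also have "\<dots> < of_int N" using l(3) unfolding N_def by (metis of_int_of_nat_eq of_nat_less_iff of_nat_power)
      finally have "1 \<le> e * of_int N" using assms by (simp add: field_simps)
      then show ?thesis using b d mult_left_mono[of 1 "e * of_int N" "real_of_int b"] by (simp add: mult_ac)
    qed
    ultimately show ?thesis by (intro exI[of _ p]) auto
  qed
  then show ?thesis using that by blast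
qed

text \<open>Large contents are covered by the short-interval lemma. For bounded content the residue
  class of 1 has bounded spacing, which is small relative to the norm of \<open>q\<close> outside a
  bounded set.\<close>

lemma finite_coprime_gap:
  assumes "e > 0"
  shows "finite {q :: int^'m. \<not> (\<forall>x::real. \<exists>p. coprime p (content_int q) \<and> \<bar>x + of_int p\<bar> \<le> e * norm (real_vec q))}"
proof -
  obtain K where K: "\<And>d x. d > K \<Longrightarrow> \<exists>p. coprime p d \<and> \<bar>(x::real) + of_int p\<bar> \<le> e * of_int d"
    using coprime_in_short_intervals[OF assms] by blast
  show ?thesis
  \<comment> \<open>The \<open>max 0\<close> keeps the bound nonnegative, so that
    \<open>q = 0\<close> obeys it as well.\<close>
  proof (rule finite_subset[OF _ finite_norm_real_vec_le[of "max 0 (of_int K / e)"]], rule subsetI)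
    fix q :: "int^'m"
    let ?d = "content_int q"
    assume "q \<in> {q. \<not> (\<forall>x::real. \<exists>p. coprime p (content_int q) \<and> \<bar>x + of_int p\<bar> \<le> e * norm (real_vec q))}"
    then obtain x :: real where x: "\<And>p. coprime p ?d \<Longrightarrow> \<not> \<bar>x + of_int p\<bar> \<le> e * norm (real_vec q)" by auto
    show "q \<in> {q. norm (real_vec q) \<le> max 0 (of_int K / e)}"
    proof (cases "q = 0")
      case False
      then have d: "?d > 0" "real_of_int ?d \<le> norm (real_vec q)"
        using content_int_nonneg[of q] content_int_eq_0_iff[of q] content_int_le_norm by auto
      have "\<not> ?d > K"
      proof
        assume "?d > K"
        then obtain p where p: "coprime p ?d" "\<bar>x + of_int p\<bar> \<le> e * of_int ?d" using K by blast
        have "e * of_int ?d \<le> e * norm (real_vec q)" using d assms by simp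
        with x[OF p(1)] p(2) show False by linarith
      qed
      \<comment> \<open>The largest integer congruent to 1 modulo \<open>?d\<close> that does not
        exceed \<open>- x\<close>.\<close>
      define p where "p = 1 + ?d * \<lfloor>(- x - 1) / of_int ?d\<rfloor>"
      have "coprime p ?d" unfolding p_def
        using coprime_mult_add_left_iff[of ?d _ 1] by (simp add: add.commute)
      have "\<bar>x + of_int p\<bar> \<le> of_int ?d"
      proof -
        define f where "f = \<lfloor>(- x - 1) / real_of_int ?d\<rfloor>"
        have "real_of_int f * of_int ?d \<le> - x - 1" "- x - 1 \<le> (real_of_int f + 1) * of_int ?d"
          using floor_correct[of "(- x - 1) / of_int ?d"] d(1) unfolding f_def[symmetric]
          by (simp_all add: le_divide_eq divide_less_eq)
        then show ?thesis by (simp add: p_def f_def[symmetric] algebra_simps abs_le_iff)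
      qed
      with x[OF \<open>coprime p ?d\<close>] \<open>\<not> ?d > K\<close> have "e * norm (real_vec q) \<le> of_int K"
        by (smt (verit) of_int_le_iff)
      then have "norm (real_vec q) \<le> of_int K / e" using assms by (simp add: le_divide_eq mult.commute)
      then show ?thesis by simp
    qed (simp add: iffD2[OF real_vec_eq_0_iff])
  qed
qed

text \<open>Gallagher's argument. For a prime \<open>l\<close> split the vectors \<open>q\<close> by the power of \<open>l\<close> in their content.
  Vectors with content not divisible by \<open>l\<close> allow the map \<open>t \<mapsto> l t\<close>; if \<open>l\<close> divides \<open>q\<close> but \<open>l\<^sup>2\<close> does not
  divide the \<open>k\<close>-th entry, then \<open>t \<mapsto> l t + e\<^sub>k / l\<close> preserves coprimality; the remaining
  vectors give a set invariant under translation by \<open>e\<^sub>k / l\<close>.\<close>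

lemma zero_one_linear_form_coprime:
  fixes W :: "int^'m::finite \<Rightarrow> real \<Rightarrow> bool"
  assumes W: "\<And>q. open {y. W q y}" "\<And>q x y. W q x \<Longrightarrow> \<bar>y\<bar> \<le> \<bar>x\<bar> \<Longrightarrow> W q y"
  defines "E \<equiv> {t. infinite {q. q \<noteq> 0 \<and> (\<exists>p. coprime p (content_int q) \<and> W q (real_vec q \<bullet> t + of_int p))}}"
  shows "negligible E \<or> negligible (- E)"
proof -
  interpret linear_form_approximation "\<lambda>p q. coprime p (content_int q)" W
  proof
    fix p and q z :: "int^'m" assume cp: "coprime p (content_int q)"
    have "content_int q dvd (\<Sum>i\<in>UNIV. q $ i * z $ i)"
      by (intro dvd_sum dvd_mult2 content_int_dvd)
    then show "coprime (p + (\<Sum>i\<in>UNIV. q $ i * z $ i)) (content_int q)"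
      using cp coprime_mult_add_left_iff[of "content_int q"] by (elim dvdE) (simp add: add.commute)
  qed (use W finite_coprime_gap in auto)
  have E: "E = often_near (- {0}) 1" by (simp add: E_def often_near_def near_def)
  define Q1 where "Q1 l k = {q. q \<noteq> 0 \<and> l dvd content_int q \<and> \<not> l\<^sup>2 dvd q $ k}" for l and k :: 'm
  define Q2 where "Q2 l = {q :: int^'m. q \<noteq> 0 \<and> (\<forall>k. l\<^sup>2 dvd q $ k)}" for l
  have coprimeI: "coprime a b" if "\<And>r. prime r \<Longrightarrow> r dvd a \<Longrightarrow> r dvd b \<Longrightarrow> False" for a b :: int
  proof (rule ccontr)
    assume "\<not> coprime a b"
    then have "\<not> is_unit (gcd a b)" by (simp add: coprime_iff_gcd_eq_1 is_unit_gcd)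
    \<comment> \<open>If the gcd is 0, every prime divides it and 2 is the witness.\<close>
    then have "\<exists>r. r dvd gcd a b \<and> prime r"
      using prime_divisor_exists[of "gcd a b"] by (cases "gcd a b = 0") (auto intro: exI[of _ 2])
    then obtain r where "prime r" "r dvd gcd a b" by blast
    then show False using that by auto
  qed
  have case0: "negligible (often_near {q. q \<noteq> 0 \<and> \<not> l dvd content_int q} 1)
      \<or> negligible (- often_near {q. q \<noteq> 0 \<and> \<not> l dvd content_int q} 1)" if l: "prime l" for l
  proof (rule zero_one_of_multiplication[where w=0 and l=l])
    fix p and q :: "int^'m" assume q: "q \<in> {q. q \<noteq> 0 \<and> \<not> l dvd content_int q}" and cp: "coprime p (content_int q)"
    have "coprime (l * p) (content_int q)" using q cp l prime_imp_coprime by auto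
    then show "\<exists>p'. coprime p' (content_int q) \<and> real_of_int p' = of_int l * of_int p - real_vec q \<bullet> 0"
      by (intro exI[of _ "l * p"]) auto
  qed (use l prime_gt_1_int in auto)
  have case1: "negligible (often_near (Q1 l k) 1) \<or> negligible (- often_near (Q1 l k) 1)" if l: "prime l" for l k
  proof (rule zero_one_of_multiplication[where w="axis k (1 / of_int l)" and l=l])
    fix p q assume q: "q \<in> Q1 l k" and cp: "coprime p (content_int q)"
    have "l dvd q $ k" using q dvd_trans[OF _ content_int_dvd] by (auto simp: Q1_def)
    then obtain a where a: "q $ k = l * a" by (elim dvdE)
    have l0: "l \<noteq> 0" using l by auto
    have la: "\<not> l dvd a" using q a by (auto simp: Q1_def power2_eq_square)
    \<comment> \<open>The shift along \<open>axis k\<close> contributes \<open>q $ k / l = a\<close>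
      to the form, hence the numerator \<open>l * p - a\<close>. A common prime \<open>r\<close>
      divides \<open>l * a\<close>: if it divides \<open>a\<close>, it divides \<open>l * p\<close>,
      so it is \<open>l\<close> or divides \<open>p\<close>; if it is \<open>l\<close>, then
      \<open>l\<close> divides \<open>a\<close>. All cases are excluded.\<close>
    have "coprime (l * p - a) (content_int q)"
    proof (rule coprimeI)
      fix r assume r: "prime r" "r dvd l * p - a" "r dvd content_int q"
      have "r dvd l * a" using dvd_trans[OF r(3) content_int_dvd[of q k]] a by simp
      then consider "r dvd a" | "r dvd l" using r(1) prime_dvd_mult_iff by blast
      then show False
      proof cases
        case 1
        then have "r dvd l * p" using r(2) by (metis diff_add_cancel dvd_add)
        then consider "r dvd l" | "r dvd p" using r(1) prime_dvd_mult_iff by blast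
        then show False
        proof cases
          case 1
          then have "r = l" using r(1) l by (simp add: primes_dvd_imp_eq)
          then show False using \<open>r dvd a\<close> la by simp
        next
          case 2
          then show False using cp r by (meson coprime_common_divisor not_prime_unit)
        qed
      next
        case 2
        then have "r = l" using r(1) l by (simp add: primes_dvd_imp_eq)
        then have "l dvd a" using r(2) dvd_diff[of l "l * p" "l * p - a"] by simp
        then show False using la by simp
      qed
    qed
    moreover have "real_of_int (l * p - a) = of_int l * of_int p - real_vec q \<bullet> axis k (1 / of_int l)"
      using a l0 by (simp add: inner_axis)
    ultimately show "\<exists>p'. coprime p' (content_int q) \<and> real_of_int p' = of_int l * of_int p - real_vec q \<bullet> axis k (1 / of_int l)"
      by blast
  qed (use l prime_gt_1_int in auto)
  have case2: "t + (1 / of_int l) *\<^sub>R real_vec z \<in> often_near (Q2 l) 1"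
    if l: "prime l" and t: "t \<in> often_near (Q2 l) 1" for l t z
  proof -
    have "t + (1 / of_int l) *\<^sub>R real_vec z \<in> near 1 q" if q: "q \<in> Q2 l" "t \<in> near 1 q" for q
    proof -
      obtain p where p: "coprime p (content_int q)" "W q (real_vec q \<bullet> t + of_int p)"
        using q(2) by (auto simp: near_def)
      have l0: "l \<noteq> 0" using l by auto
      have "l\<^sup>2 dvd (\<Sum>i\<in>UNIV. q $ i * z $ i)" using q(1) by (auto simp: Q2_def intro!: dvd_sum)
      then obtain u where u: "(\<Sum>i\<in>UNIV. q $ i * z $ i) = l * (l * u)"
        unfolding power2_eq_square mult.assoc by (elim dvdE) (simp only: mult.assoc)
      have d: "content_int q dvd l * (l * u)"
        unfolding u[symmetric] by (intro dvd_sum dvd_mult2 content_int_dvd)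
      \<comment> \<open>The translation changes the form by \<open>l * u\<close>. A prime dividing
        the content divides \<open>l * (l * u)\<close>, hence \<open>l * u\<close>, so
        \<open>p\<close> and \<open>p - l * u\<close> agree modulo it.\<close>
      have "coprime (p - l * u) (content_int q)"
      proof (rule coprimeI)
        fix r assume r: "prime r" "r dvd p - l * u" "r dvd content_int q"
        have "r dvd l * (l * u)" using dvd_trans[OF r(3) d] .
        then have "r dvd l * u" using r(1) prime_dvd_mult_iff dvd_mult2 by blast
        then have "r dvd p" using r(2) by (metis diff_add_cancel dvd_add)
        then show False using p(1) r by (meson coprime_common_divisor not_prime_unit)
      qed
      moreover have "real_vec q \<bullet> (t + (1 / of_int l) *\<^sub>R real_vec z) + of_int (p - l * u) = real_vec q \<bullet> t + of_int p"
        using l0 by (simp add: inner_add_right inner_real_vec u)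
      ultimately show ?thesis using p(2) unfolding near_def by (metis (mono_tags, lifting) mem_Collect_eq mult_1)
    qed
    then have "{q\<in>Q2 l. t \<in> near 1 q} \<subseteq> {q\<in>Q2 l. t + (1 / of_int l) *\<^sub>R real_vec z \<in> near 1 q}" by auto
    then show ?thesis using t unfolding often_near_def by (auto dest: finite_subset)
  qed
  have split: "E \<subseteq> often_near {q. q \<noteq> 0 \<and> \<not> l dvd content_int q} 1 \<union> (\<Union>k. often_near (Q1 l k) 1) \<union> often_near (Q2 l) 1" for l
  proof
    fix t assume t: "t \<in> E"
    let ?F = "\<lambda>Q. {q\<in>Q. t \<in> near 1 q}"
    have "?F (- {0}) \<subseteq> ?F {q. q \<noteq> 0 \<and> \<not> l dvd content_int q} \<union> (\<Union>k. ?F (Q1 l k)) \<union> ?F (Q2 l)"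
      by (auto simp: Q1_def Q2_def)
    moreover have "infinite (?F (- {0}))" using t unfolding E often_near_def by simp
    ultimately have "\<not> finite (?F {q. q \<noteq> 0 \<and> \<not> l dvd content_int q} \<union> (\<Union>k. ?F (Q1 l k)) \<union> ?F (Q2 l))"
      using finite_subset by blast
    then show "t \<in> often_near {q. q \<noteq> 0 \<and> \<not> l dvd content_int q} 1 \<union> (\<Union>k. often_near (Q1 l k) 1) \<union> often_near (Q2 l) 1"
      unfolding often_near_def by auto
  qed
  have sub: "often_near Q 1 \<subseteq> E" if "0 \<notin> Q" for Q
    unfolding E using that by (intro often_near_mono) auto
  show ?thesis
  proof (rule ccontr)
    assume neg: "\<not> (negligible E \<or> negligible (- E))"
    \<comment> \<open>Each piece lies in \<open>E\<close>, so none is conegligible; those with a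
      zero-one law are therefore null, and \<open>E\<close> agrees up to a null set with the part
      from \<open>Q2 l\<close>, for every prime \<open>l\<close>.\<close>
    then have "\<not> negligible (- often_near Q 1)" if "0 \<notin> Q" for Q
      using sub[OF that] negligible_subset[of "- often_near Q 1" "- E"] by blast
    then have "negligible (often_near {q. q \<noteq> 0 \<and> \<not> l dvd content_int q} 1)" "\<And>k. negligible (often_near (Q1 l k) 1)"
      if "prime l" for l
      using case0[OF that] case1[OF that] by (auto simp: Q1_def)
    then have small: "negligible (often_near {q. q \<noteq> 0 \<and> \<not> l dvd content_int q} 1 \<union> (\<Union>k. often_near (Q1 l k) 1))"
      if "prime l" for l using that by (intro negligible_Un negligible_Union) auto
    have almost: "negligible (E - often_near (Q2 l) 1)" if "prime l" for l
      by (rule negligible_subset[OF small[OF that]]) (use split[of l] in blast)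
    have "negligible E \<or> negligible (- E)"
    proof (rule negligible_or_conegligible_translations)
      show "E \<in> sets lebesgue" unfolding E by (rule often_near_lebesgue)
      fix w :: "real^'m" and e :: real assume "e > 0"
      \<comment> \<open>Rounding the coordinates of \<open>w\<close> down to multiples of
        \<open>1 / l\<close> moves it by at most \<open>CARD('m) / l\<close>, which is below
        \<open>e\<close> for a large prime \<open>l\<close>.\<close>
      obtain n where n: "prime n" "n > nat \<lceil>real CARD('m) / e\<rceil>"
        using bigger_prime by blast
      define l where "l = int n"
      have l: "prime l" using n by (simp add: l_def)
      then have l0: "real_of_int l > 0" using prime_gt_0_int by auto
      have "real CARD('m) / e < of_int l" using n(2) unfolding l_def by linarith
      then have le: "real CARD('m) / of_int l < e" using \<open>e > 0\<close> l0 by (simp add: field_simps)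
      define z :: "int^'m" where "z = (\<chi> i. \<lfloor>of_int l * w $ i\<rfloor>)"
      define v where "v = (1 / of_int l) *\<^sub>R real_vec z"
      have "\<bar>(v - w) $ i\<bar> \<le> 1 / of_int l" for i
      proof -
        have "v $ i = of_int \<lfloor>of_int l * w $ i\<rfloor> / of_int l" by (simp add: v_def z_def)
        moreover have "w $ i = (of_int l * w $ i) / of_int l" using l0 by simp
        ultimately have "(v - w) $ i = (of_int \<lfloor>of_int l * w $ i\<rfloor> - of_int l * w $ i) / of_int l"
          by (simp add: diff_divide_distrib)
        moreover have "\<bar>of_int \<lfloor>of_int l * w $ i\<rfloor> - of_int l * w $ i\<bar> \<le> 1" by linarith
        ultimately show ?thesis using l0 by (simp add: divide_right_mono)
      qed
      then have "(\<Sum>i\<in>UNIV. \<bar>(v - w) $ i\<bar>) \<le> (\<Sum>i\<in>(UNIV::'m set). 1 / of_int l)" by (intro sum_mono)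
      then have "dist v w \<le> real CARD('m) / of_int l"
        using norm_le_l1_cart[of "v - w"] by (simp add: dist_norm)
      moreover have "negligible {x. x \<notin> E \<and> x + v \<in> E}"
      proof (rule negligible_subset[OF negligible_translation[OF almost[OF l], of "- v"]], rule subsetI)
        fix x assume x: "x \<in> {x. x \<notin> E \<and> x + v \<in> E}"
        have "x + v \<notin> often_near (Q2 l) 1"
        proof
          assume "x + v \<in> often_near (Q2 l) 1"
          then have "x + v + (1 / of_int l) *\<^sub>R real_vec (- z) \<in> often_near (Q2 l) 1" by (rule case2[OF l])
          moreover have "x + v + (1 / of_int l) *\<^sub>R real_vec (- z) = x"
            by (simp add: v_def vec_eq_iff)
          ultimately show False using x sub[of "Q2 l"] by (auto simp: Q2_def)
        qed
        then show "x \<in> (+) (- v) ` (E - often_near (Q2 l) 1)"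
          using x by (intro image_eqI[of _ _ "x + v"]) auto
      qed
      ultimately show "\<exists>v. dist v w < e \<and> negligible {x. x \<notin> E \<and> x + v \<in> E}"
        using le by (intro exI[of _ v]) auto
    qed
    with neg show False by simp
  qed
qed

subsection \<open>Fibres along columns\<close>

text \<open>Integrate the indicator of \<open>x + L t \<in> N\<close> over \<open>x\<close> and
  \<open>t\<close>. The fibres give 0; integrating over \<open>x\<close> first gives, by translation
  invariance, the measure of \<open>N\<close> for every \<open>t\<close>, and a constant has
  integral 0 over a space of infinite measure only if it is 0.\<close>

lemma negligible_of_fibres:
  fixes N :: "'a::euclidean_space set" and L :: "'b::euclidean_space \<Rightarrow> 'a"
  assumes N: "N \<in> sets borel" and L: "continuous_on UNIV L"
    and fib: "\<And>x. negligible {t. x + L t \<in> N}"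
  shows "negligible N"
proof -
  have [measurable]: "L \<in> borel_measurable borel" using L by (rule borel_measurable_continuous_onI)
  have [measurable]: "N \<in> sets borel" by fact
  let ?f = "\<lambda>x t. indicator N (x + L t) :: ennreal"
  have "(\<integral>\<^sup>+x. (\<integral>\<^sup>+t. ?f x t \<partial>lborel) \<partial>lborel) = (\<integral>\<^sup>+t. (\<integral>\<^sup>+x. ?f x t \<partial>lborel) \<partial>lborel)"
    using lborel_pair.Fubini'[of ?f] by simp
  moreover have "(\<integral>\<^sup>+t. ?f x t \<partial>lborel) = 0" for x
  proof -
    have m: "{t. x + L t \<in> N} \<in> sets lborel" by measurable
    have "(\<integral>\<^sup>+t. ?f x t \<partial>lborel) = (\<integral>\<^sup>+t. indicator {t. x + L t \<in> N} t \<partial>lborel)"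
      by (intro nn_integral_cong) (auto simp: indicator_def)
    also have "\<dots> = emeasure lborel {t. x + L t \<in> N}" using m by (rule nn_integral_indicator)
    also have "\<dots> = emeasure lebesgue {t. x + L t \<in> N}" using m by simp
    also have "\<dots> = 0" using fib by (simp add: negligible_iff_null_sets null_setsD1)
    finally show ?thesis .
  qed
  moreover have "(\<integral>\<^sup>+x. ?f x t \<partial>lborel) = emeasure lborel N" for t
  proof -
    have "emeasure lborel N = (\<integral>\<^sup>+x. indicator N x \<partial>distr lborel borel ((+) (L t)))"
      by (simp add: lborel_distr_plus)
    also have "\<dots> = (\<integral>\<^sup>+x. indicator N (L t + x) \<partial>lborel)"
      by (subst nn_integral_distr) auto
    finally show ?thesis by (simp add: add.commute)
  qed
  ultimately have "emeasure lborel N = 0"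
    by (simp add: ennreal_mult_eq_top_iff emeasure_lborel_UNIV)
  then show ?thesis using N by (simp add: negligible_iff_null_sets null_sets_def)
qed

definition column_embed :: "'n \<Rightarrow> real^'m \<Rightarrow> real^'n^'m" where
  "column_embed j t = (\<chi> i k. if k = j then t $ i else 0)"

lemma continuous_on_column_embed: "continuous_on UNIV (column_embed j :: real^'m \<Rightarrow> real^'n^'m)"
proof -
  have "linear (column_embed j :: real^'m \<Rightarrow> real^'n^'m)"
    by (rule linearI) (simp_all add: column_embed_def vec_eq_iff)
  then show ?thesis by (rule linear_continuous_on[OF linear_conv_bounded_linear[THEN iffD1]])
qed

lemma sum_column_embed: "(\<Sum>j\<in>UNIV. column_embed j (\<chi> i. V $ i $ j)) = V"
  by (simp add: vec_eq_iff column_embed_def)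

lemma column_embed_add: "column_embed j (s + t) = column_embed j s + column_embed j t"
  by (simp add: vec_eq_iff column_embed_def)

lemma vector_matrix_column_embed:
  "(x v* (X + column_embed j t)) $ k = (x v* X) $ k + (if k = j then x \<bullet> t else 0)"
  by (simp add: vector_matrix_mult_def column_embed_def inner_vec_def sum.distrib distrib_left mult.commute)

text \<open>Moving a column by \<open>s\<close> translates the fibre, and a null or conull fibre
  agrees with its translate up to a null set. Fubini lifts this to \<open>E\<close>, and every
  translation is a sum of column translations.\<close>

lemma negligible_or_conegligible_columns:
  fixes E :: "(real^'n^'m) set"
  assumes E: "E \<in> sets borel"
    and fib: "\<And>X j. negligible {t. X + column_embed j t \<in> E} \<or> negligible (- {t. X + column_embed j t \<in> E})"
  shows "negligible E \<or> negligible (- E)"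
proof (rule negligible_or_conegligible_translations)
  show "E \<in> sets lebesgue" using E by (simp add: sets_completionI_sets)
  define P where "P V \<longleftrightarrow> negligible {Z. Z \<notin> E \<and> Z + V \<in> E}" for V
  have column: "P (column_embed j s)" for j s
    unfolding P_def
  proof (rule negligible_of_fibres[OF _ continuous_on_column_embed[of j]])
    show "{Z. Z \<notin> E \<and> Z + column_embed j s \<in> E} \<in> sets borel"
      using E by measurable
    fix X
    let ?F = "{t. X + column_embed j t \<in> E}"
    have "{t. X + column_embed j t \<in> {Z. Z \<notin> E \<and> Z + column_embed j s \<in> E}} \<subseteq> - ?F \<inter> (+) (- s) ` ?F"
    proof
      fix t assume t: "t \<in> {t. X + column_embed j t \<in> {Z. Z \<notin> E \<and> Z + column_embed j s \<in> E}}"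
      then have "s + t \<in> ?F" by (simp add: column_embed_add add_ac)
      then have "t \<in> (+) (- s) ` ?F" by (rule image_eqI[rotated]) simp
      then show "t \<in> - ?F \<inter> (+) (- s) ` ?F" using t by simp
    qed
    moreover have "negligible (- ?F \<inter> (+) (- s) ` ?F)"
      using fib[of X j] negligible_translation[of ?F "- s"] negligible_subset
      by (metis inf_le1 inf_le2)
    ultimately show "negligible {t. X + column_embed j t \<in> {Z. Z \<notin> E \<and> Z + column_embed j s \<in> E}}"
      by (rule negligible_subset[rotated])
  qed
  have add: "P (V + V')" if "P V" "P V'" for V V'
  proof -
    have "negligible ((+) (- V) ` {Z. Z \<notin> E \<and> Z + V' \<in> E})"
      using that(2) unfolding P_def by (rule negligible_translation)
    then have "negligible ({Z. Z \<notin> E \<and> Z + V \<in> E} \<union> (+) (- V) ` {Z. Z \<notin> E \<and> Z + V' \<in> E})"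
      using that(1) unfolding P_def by (rule negligible_Un[rotated])
    moreover have "{Z. Z \<notin> E \<and> Z + (V + V') \<in> E} \<subseteq> {Z. Z \<notin> E \<and> Z + V \<in> E} \<union> (+) (- V) ` {Z. Z \<notin> E \<and> Z + V' \<in> E}"
    proof
      fix Z assume Z: "Z \<in> {Z. Z \<notin> E \<and> Z + (V + V') \<in> E}"
      show "Z \<in> {Z. Z \<notin> E \<and> Z + V \<in> E} \<union> (+) (- V) ` {Z. Z \<notin> E \<and> Z + V' \<in> E}"
      proof (cases "Z + V \<in> E")
        case False
        then have "Z + V \<in> {Z. Z \<notin> E \<and> Z + V' \<in> E}" using Z by (simp add: add.assoc)
        then have "Z \<in> (+) (- V) ` {Z. Z \<notin> E \<and> Z + V' \<in> E}" by (rule image_eqI[rotated]) simp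
        then show ?thesis by blast
      qed (use Z in auto)
    qed
    ultimately show ?thesis unfolding P_def by (rule negligible_subset)
  qed
  have "P (\<Sum>j\<in>J. column_embed j (\<chi> i. V $ i $ j))" if "finite J" for J V
    using that
  proof (induction J)
    case empty then show ?case by (simp add: P_def)
  next
    case (insert j J)
    then show ?case using add[OF column] by simp
  qed
  then have all: "P V" for V using sum_column_embed[of V] by (metis finite)
  fix w :: "real^'n^'m" and e :: real assume "e > 0"
  then show "\<exists>v. dist v w < e \<and> negligible {z. z \<notin> E \<and> z + v \<in> E}"
    using all[of w] unfolding P_def by (intro exI[of _ w]) simp
qed

section \<open>The multiplicative sets, counted by \<open>q\<close>\<close>

lemma mult_solution_open: "open {X :: real^'n^'m. mult_solution \<Psi> X p q}"
proof -
  have "continuous_on UNIV (\<lambda>X :: real^'n^'m. height_prod (real_vec q v* X + real_vec p))"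
    unfolding height_prod_def vector_matrix_mult_def
    by (simp, intro continuous_intros)
  then have "open {X :: real^'n^'m. height_prod (real_vec q v* X + real_vec p) < \<Psi> q}"
    by (intro open_Collect_less) auto
  then show ?thesis unfolding mult_solution_def by (cases "q = 0") auto
qed

text \<open>Counting vectors \<open>q\<close> instead of pairs makes the fibres along a column
  translates of the limsup sets for one linear form.\<close>

definition often_mult :: "(int \<Rightarrow> int^'m \<Rightarrow> bool) \<Rightarrow> (int^'m \<Rightarrow> real) \<Rightarrow> (real^'n^'m) set" where
  "often_mult R \<Psi> = {X. infinite {q. \<exists>p. (\<forall>i. R (p $ i) q) \<and> mult_solution \<Psi> X p q}}"

lemma often_mult_borel: "(often_mult R \<Psi> :: (real^'n^'m) set) \<in> sets borel"
proof -
  define U where "U q = (\<Union>p\<in>{p. \<forall>i. R (p $ i) q}. {X :: real^'n^'m. mult_solution \<Psi> X p q})" for q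
  have "U q \<in> sets borel" for q
    unfolding U_def by (intro borel_open open_UN) (simp add: mult_solution_open)
  then have "{X. infinite {q \<in> UNIV. X \<in> U q}} \<in> sets borel" by (rule infinitely_often_borel)
  moreover have "often_mult R \<Psi> = {X. infinite {q \<in> UNIV. X \<in> U q}}"
    by (simp add: often_mult_def U_def)
  ultimately show ?thesis by simp
qed

text \<open>The product is the absolute value of one linear form in column \<open>j\<close> times
  factors free of that column, so \<open>one\<close> applies to each fibre.\<close>

lemma often_mult_zero_one:
  fixes R :: "int \<Rightarrow> int^'m \<Rightarrow> bool"
  assumes one: "\<And>W. \<lbrakk>\<And>q. open {y. W q y}; \<And>q x y. W q x \<Longrightarrow> \<bar>y\<bar> \<le> \<bar>x\<bar> \<Longrightarrow> W q y\<rbrakk> \<Longrightarrow>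
      negligible {t. infinite {q. q \<noteq> 0 \<and> (\<exists>p. R p q \<and> W q (real_vec q \<bullet> t + of_int p))}} \<or>
      negligible (- {t. infinite {q. q \<noteq> 0 \<and> (\<exists>p. R p q \<and> W q (real_vec q \<bullet> t + of_int p))}})"
  shows "negligible (often_mult R \<Psi> :: (real^'n^'m) set) \<or> negligible (- (often_mult R \<Psi> :: (real^'n^'m) set))"
proof (rule negligible_or_conegligible_columns[OF often_mult_borel])
  fix X :: "real^'n^'m" and j
  \<comment> \<open>\<open>y\<close> stands for the \<open>j\<close>-th factor. The numerators of
    the other columns are quantified away, which leaves an open symmetric condition on
    \<open>y\<close> depending on \<open>q\<close>.\<close>
  define W where "W q y \<longleftrightarrow> (\<exists>p :: int^'n. (\<forall>i. i \<noteq> j \<longrightarrow> R (p $ i) q) \<and>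
    \<bar>y\<bar> * (\<Prod>i\<in>UNIV - {j}. \<bar>(real_vec q v* X) $ i + of_int (p $ i)\<bar>) < \<Psi> q)" for q and y :: real
  define A where "A = {t. infinite {q. q \<noteq> 0 \<and> (\<exists>p. R p q \<and> W q (real_vec q \<bullet> t + of_int p))}}"
  have A: "negligible A \<or> negligible (- A)"
    unfolding A_def
  proof (rule one)
    fix q
    have "{y. W q y} = (\<Union>p\<in>{p :: int^'n. \<forall>i. i \<noteq> j \<longrightarrow> R (p $ i) q}.
        {y. \<bar>y\<bar> * (\<Prod>i\<in>UNIV - {j}. \<bar>(real_vec q v* X) $ i + of_int (p $ i)\<bar>) < \<Psi> q})"
      by (auto simp: W_def)
    also have "open \<dots>"
      by (intro open_UN ballI open_Collect_less continuous_intros)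
    finally show "open {y. W q y}" .
  next
    fix q and x y :: real assume "W q x" "\<bar>y\<bar> \<le> \<bar>x\<bar>"
    then show "W q y" unfolding W_def by (meson mult_right_mono prod_nonneg abs_ge_zero order_le_less_trans)
  qed
  \<comment> \<open>The column already present in \<open>X\<close>: the fibre is \<open>A\<close>
    shifted by \<open>- t0\<close>.\<close>
  define t0 where "t0 = (\<chi> i. X $ i $ j)"
  have t0: "real_vec q \<bullet> t0 = (real_vec q v* X) $ j" for q
    by (simp add: t0_def inner_vec_def vector_matrix_mult_def mult.commute)
  have iff: "(\<exists>p. (\<forall>i. R (p $ i) q) \<and> mult_solution \<Psi> (X + column_embed j t) p q) \<longleftrightarrow>
      q \<noteq> 0 \<and> (\<exists>p. R p q \<and> W q (real_vec q \<bullet> (t0 + t) + of_int p))" for t q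
  proof -
    have hp: "height_prod (real_vec q v* (X + column_embed j t) + real_vec p) =
        \<bar>real_vec q \<bullet> (t0 + t) + of_int (p $ j)\<bar> * (\<Prod>i\<in>UNIV - {j}. \<bar>(real_vec q v* X) $ i + of_int (p $ i)\<bar>)" for p
      unfolding height_prod_def
      by (subst prod.remove[of UNIV j]) (simp_all add: vector_matrix_column_embed inner_add_right t0)
    show ?thesis
    proof
      assume "\<exists>p. (\<forall>i. R (p $ i) q) \<and> mult_solution \<Psi> (X + column_embed j t) p q"
      then show "q \<noteq> 0 \<and> (\<exists>p. R p q \<and> W q (real_vec q \<bullet> (t0 + t) + of_int p))"
        unfolding mult_solution_def hp W_def by blast
    next
      assume "q \<noteq> 0 \<and> (\<exists>p. R p q \<and> W q (real_vec q \<bullet> (t0 + t) + of_int p))"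
      then obtain p' p where p: "q \<noteq> 0" "R p' q" "\<And>i. i \<noteq> j \<Longrightarrow> R (p $ i) q"
        "\<bar>real_vec q \<bullet> (t0 + t) + of_int p'\<bar> * (\<Prod>i\<in>UNIV - {j}. \<bar>(real_vec q v* X) $ i + of_int (p $ i)\<bar>) < \<Psi> q"
        unfolding W_def by blast
      define p'' where "p'' = (\<chi> i. if i = j then p' else p $ i)"
      have "(\<Prod>i\<in>UNIV - {j}. \<bar>(real_vec q v* X) $ i + of_int (p'' $ i)\<bar>) =
          (\<Prod>i\<in>UNIV - {j}. \<bar>(real_vec q v* X) $ i + of_int (p $ i)\<bar>)"
        by (intro prod.cong) (auto simp: p''_def)
      then have "mult_solution \<Psi> (X + column_embed j t) p'' q"
        unfolding mult_solution_def hp using p(1,4) by (simp add: p''_def)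
      moreover have "\<forall>i. R (p'' $ i) q" using p(2,3) by (simp add: p''_def)
      ultimately show "\<exists>p. (\<forall>i. R (p $ i) q) \<and> mult_solution \<Psi> (X + column_embed j t) p q" by blast
    qed
  qed
  have F: "{t. X + column_embed j t \<in> often_mult R \<Psi>} = {t. t0 + t \<in> A}"
    unfolding often_mult_def A_def by (simp add: iff)
  have "A = (+) t0 ` {t. t0 + t \<in> A}" "- A = (+) t0 ` (- {t. t0 + t \<in> A})"
    by (auto intro: image_eqI[of _ _ "_ - t0"])
  then show "negligible {t. X + column_embed j t \<in> often_mult R \<Psi>} \<or> negligible (- {t. X + column_embed j t \<in> often_mult R \<Psi>})"
    unfolding F using A negligible_translation_rev by metis
qed

section \<open>From vectors \<open>q\<close> to pairs \<open>(p, q)\<close> in the unit cube\<close>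

lemma negligible_rational_hyperplanes:
  "negligible {X :: real^'n^'m. \<exists>q z j. q \<noteq> 0 \<and> (real_vec q v* X) $ j = of_int z}"
proof -
  have "negligible {X :: real^'n^'m. (real_vec q v* X) $ j = of_int z}" if q: "q \<noteq> 0" for q z j
  proof -
    \<comment> \<open>The condition defines a hyperplane in matrix space whose normal has
      \<open>q\<close> as its \<open>j\<close>-th column and zeros elsewhere.\<close>
    have eq: "column_embed j (real_vec q) \<bullet> X = (real_vec q v* X) $ j" for X :: "real^'n^'m"
      by (simp add: inner_vec_def column_embed_def vector_matrix_mult_def if_distrib[of "\<lambda>x. _ * x"] mult.commute cong: if_cong)
    have "column_embed j (real_vec q) \<noteq> (0 :: real^'n^'m)"
    proof
      assume "column_embed j (real_vec q) = (0 :: real^'n^'m)"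
      then have "column_embed j (real_vec q) $ i $ j = (0 :: real)" for i by simp
      then have "real_vec q = 0" by (simp add: column_embed_def vec_eq_iff)
      then show False using q by simp
    qed
    then have "negligible {X :: real^'n^'m. column_embed j (real_vec q) \<bullet> X = of_int z}"
      by (intro negligible_hyperplane) simp
    then show ?thesis by (simp only: eq)
  qed
  then have "negligible (\<Union>(q, z, j)\<in>{(q, z, j). q \<noteq> 0}. {X :: real^'n^'m. (real_vec q v* X) $ j = of_int z})"
    by (intro negligible_countable_Union countable_image) auto
  then show ?thesis by (rule negligible_subset) auto
qed

text \<open>No factor falls below the least distance \<open>d\<close> of a coordinate of
  \<open>y\<close> to the integers, so a product below \<open>c\<close> bounds each single factor
  and with it \<open>p\<close>.\<close>

lemma finite_solutions_fixed_q:
  fixes y :: "real^'n"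
  assumes "\<And>j z. y $ j \<noteq> of_int z"
  shows "finite {p. height_prod (y + real_vec p) < c}"
proof -
  define d where "d = Min (range (\<lambda>j. min (frac (y $ j)) (1 - frac (y $ j))))"
  have dpos: "d > 0"
  proof -
    have "frac (y $ j) > 0" for j
      using assms[of j] frac_ge_0[of "y $ j"] by (metis Ints_cases frac_gt_0_iff)
    then show ?thesis unfolding d_def by (auto simp: frac_lt_1)
  qed
  have d: "d \<le> \<bar>y $ j + of_int z\<bar>" for j z
  proof -
    have "d \<le> min (frac (y $ j)) (1 - frac (y $ j))" unfolding d_def by (intro Min_le) auto
    then have dd: "d \<le> frac (y $ j)" "d \<le> 1 - frac (y $ j)" by auto
    have y: "y $ j = of_int \<lfloor>y $ j\<rfloor> + frac (y $ j)" by (simp add: frac_def)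
    show ?thesis
    proof (cases "\<lfloor>y $ j\<rfloor> + z \<ge> 0")
      case True
      then have "real_of_int (\<lfloor>y $ j\<rfloor> + z) \<ge> 0" by linarith
      then show ?thesis using dd y by (simp add: abs_if) 
    next
      case False
      then have "real_of_int (\<lfloor>y $ j\<rfloor> + z) \<le> -1" by linarith
      then show ?thesis using dd y by (simp add: abs_if) 
    qed
  qed
  define K where "K = norm y + \<bar>c\<bar> / d ^ (CARD('n) - 1)"
  have "\<bar>p $ j\<bar> \<le> \<lceil>K\<rceil>" if p: "height_prod (y + real_vec p) < c" for p j
  proof -
    have "d ^ (CARD('n) - 1) = (\<Prod>i\<in>UNIV - {j}. d)" by simp
    also have "\<dots> \<le> (\<Prod>i\<in>UNIV - {j}. \<bar>(y + real_vec p) $ i\<bar>)"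
      using d dpos by (intro prod_mono) (auto simp: less_imp_le)
    finally have "\<bar>y $ j + of_int (p $ j)\<bar> * d ^ (CARD('n) - 1) \<le> \<bar>(y + real_vec p) $ j\<bar> * (\<Prod>i\<in>UNIV - {j}. \<bar>(y + real_vec p) $ i\<bar>)"
      by (simp add: mult_left_mono)
    also have "\<dots> = height_prod (y + real_vec p)"
      unfolding height_prod_def using prod.remove[of UNIV j "\<lambda>i. \<bar>(y + real_vec p) $ i\<bar>"] by simp
    finally have "\<bar>y $ j + of_int (p $ j)\<bar> * d ^ (CARD('n) - 1) \<le> \<bar>c\<bar>" using p by linarith
    then have "\<bar>y $ j + of_int (p $ j)\<bar> \<le> \<bar>c\<bar> / d ^ (CARD('n) - 1)" using dpos by (simp add: le_divide_eq)
    moreover have "\<bar>y $ j\<bar> \<le> norm y" by (rule component_le_norm_cart)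
    ultimately have "real_of_int \<bar>p $ j\<bar> \<le> K" unfolding K_def by linarith
    then show ?thesis by linarith
  qed
  then have "{p. height_prod (y + real_vec p) < c} \<subseteq> vec_lambda ` (\<Pi>\<^sub>E i\<in>UNIV. {- \<lceil>K\<rceil> .. \<lceil>K\<rceil>})"
    by (auto intro!: image_eqI[of _ _ "\<lambda>i. _ $ i"] simp: abs_le_iff) (metis minus_le_iff)
  moreover have "finite (vec_lambda ` (\<Pi>\<^sub>E i\<in>(UNIV :: 'n set). {- \<lceil>K\<rceil> .. \<lceil>K\<rceil>}))"
    by (intro finite_imageI finite_PiE) auto
  ultimately show ?thesis by (rule finite_subset)
qed

lemma unit_cube_eq_cbox: "(unit_cube :: (real^'n^'m) set) = cbox 0 One"
proof -
  have "(\<forall>b\<in>Basis. 0 \<le> X \<bullet> b \<and> X \<bullet> b \<le> 1) \<longleftrightarrow> (\<forall>i j. 0 \<le> X $ i $ j \<and> X $ i $ j \<le> 1)" for X :: "real^'n^'m"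
    by (force simp: Basis_vec_def inner_axis)
  then show ?thesis
    by (simp add: unit_cube_def set_eq_iff mem_box)
qed

text \<open>Infinitely many \<open>q\<close> give infinitely many pairs. Conversely, off the
  rational hyperplanes each \<open>q\<close> has only finitely many \<open>p\<close>, so within the
  cube \<open>S\<close> differs from a Borel set by a null set.\<close>

lemma often_mult_unit_cube:
  fixes R :: "int \<Rightarrow> int^'m \<Rightarrow> bool" and \<Psi> :: "int^'m \<Rightarrow> real"
  defines "S \<equiv> {X :: real^'n^'m. X \<in> unit_cube \<and> infinite {(p, q). mult_solution \<Psi> X p q \<and> (\<forall>i. R (p $ i) q)}}"
  assumes zo: "negligible (often_mult R \<Psi> :: (real^'n^'m) set) \<or> negligible (- (often_mult R \<Psi> :: (real^'n^'m) set))"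
  shows "S \<in> sets lebesgue \<and> (emeasure lebesgue S = 0 \<or> emeasure lebesgue S = 1)"
proof -
  let ?E = "often_mult R \<Psi> :: (real^'n^'m) set"
  let ?H = "{X :: real^'n^'m. \<exists>q z j. q \<noteq> 0 \<and> (real_vec q v* X) $ j = of_int z}"
  let ?P = "\<lambda>X :: real^'n^'m. {(p, q). mult_solution \<Psi> X p q \<and> (\<forall>i. R (p $ i) q)}"
  have q: "{q. \<exists>p. (\<forall>i. R (p $ i) q) \<and> mult_solution \<Psi> X p q} = snd ` ?P X" for X
    by (auto simp: image_iff) blast+
  have up: "?E \<inter> unit_cube \<subseteq> S"
    unfolding S_def often_mult_def q by auto
  have down: "S - ?E \<subseteq> ?H"
  proof
    fix X assume X: "X \<in> S - ?E"
    then have fin: "finite (snd ` ?P X)" and inf: "infinite (?P X)"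
      by (simp_all add: S_def often_mult_def q)
    show "X \<in> ?H"
    proof (rule ccontr)
      assume no: "X \<notin> ?H"
      have "?P X \<subseteq> (\<Union>q\<in>snd ` ?P X. {p. height_prod (real_vec q v* X + real_vec p) < \<Psi> q} \<times> {q})"
        by (force simp: mult_solution_def)
      moreover have "finite (\<Union>q\<in>snd ` ?P X. {p. height_prod (real_vec q v* X + real_vec p) < \<Psi> q} \<times> {q})"
        using fin
      proof (rule finite_UN_I)
        fix q assume "q \<in> snd ` ?P X"
        then have "q \<noteq> 0" by (auto simp: mult_solution_def)
        then show "finite ({p. height_prod (real_vec q v* X + real_vec p) < \<Psi> q} \<times> {q})"
          using no by (intro finite_cartesian_product finite_solutions_fixed_q) auto
      qed
      ultimately show False using inf finite_subset by blast
    qed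
  qed
  have neg: "negligible (S - ?E)" using negligible_rational_hyperplanes down by (rule negligible_subset)
  have S: "S = (?E \<inter> unit_cube) \<union> (S - ?E)" using up by (auto simp: S_def)
  have Em: "?E \<inter> unit_cube \<in> sets lebesgue"
    unfolding unit_cube_eq_cbox by (intro sets_completionI_sets) (simp add: sets.Int often_mult_borel)
  then have Sm: "S \<in> sets lebesgue" using sets.Un[OF Em negligible_imp_sets[OF neg]] S by simp
  have "emeasure lebesgue S = 0 \<or> emeasure lebesgue S = 1"
    using zo
  proof
    assume "negligible ?E"
    then have "negligible (?E \<union> (S - ?E))" using neg by (rule negligible_Un)
    then have "negligible S" by (rule negligible_subset) auto
    then show ?thesis by (simp add: negligible_iff_null_sets null_setsD1)
  next
    assume "negligible (- ?E)"
    then have "negligible (unit_cube - S)" by (rule negligible_subset) (use up in auto)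
    then have "unit_cube - S \<in> null_sets lebesgue" by (simp add: negligible_iff_null_sets)
    then have "emeasure lebesgue (S \<union> (unit_cube - S)) = emeasure lebesgue S"
      using Sm by (intro emeasure_Un_null_set)
    moreover have "S \<union> (unit_cube - S) = cbox 0 One" unfolding unit_cube_eq_cbox[symmetric] by (auto simp: S_def)
    moreover have "emeasure lebesgue (cbox 0 One :: (real^'n^'m) set) = 1"
      by (simp add: emeasure_lborel_cbox_eq)
    ultimately show ?thesis by simp
  qed
  with Sm show ?thesis by simp
qed

lemma Gcd_insert_range_eq_1_iff: "Gcd (insert a (range (\<lambda>k. q $ k))) = 1 \<longleftrightarrow> coprime a (content_int q)"
  by (simp add: content_int_def coprime_iff_gcd_eq_1)

theorem theorem4:
  fixes \<Psi> :: "int^'m::finite \<Rightarrow> real"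
  assumes "\<And>q. 0 \<le> \<Psi> q"
  shows "(S_mult \<Psi> :: (real^'n::finite^'m) set) \<in> sets lebesgue \<and>
         (emeasure lebesgue (S_mult \<Psi> :: (real^'n^'m) set) = 0 \<or>
          emeasure lebesgue (S_mult \<Psi> :: (real^'n^'m) set) = 1) \<and>
         (D_mult \<Psi> :: (real^'n^'m) set) \<in> sets lebesgue \<and>
         (emeasure lebesgue (D_mult \<Psi> :: (real^'n^'m) set) = 0 \<or>
          emeasure lebesgue (D_mult \<Psi> :: (real^'n^'m) set) = 1)"
proof -
  \<comment> \<open>The vacuous condition on \<open>p\<close> gives the set the common shape, with
    \<open>R\<close> constantly true.\<close>
  have "S_mult \<Psi> = {X :: real^'n^'m. X \<in> unit_cube \<and> infinite {(p, q). mult_solution \<Psi> X p q \<and> (\<forall>i. True)}}"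
    by (simp add: S_mult_def)
  moreover have "negligible (often_mult (\<lambda>_ _. True) \<Psi> :: (real^'n^'m) set) \<or>
      negligible (- (often_mult (\<lambda>_ _. True) \<Psi> :: (real^'n^'m) set))"
    by (rule often_mult_zero_one, simp only: simp_thms, rule zero_one_linear_form) auto
  ultimately have S: "(S_mult \<Psi> :: (real^'n^'m) set) \<in> sets lebesgue \<and>
      (emeasure lebesgue (S_mult \<Psi> :: (real^'n^'m) set) = 0 \<or> emeasure lebesgue (S_mult \<Psi> :: (real^'n^'m) set) = 1)"
    using often_mult_unit_cube[of "\<lambda>_ _. True" \<Psi>] by simp
  let ?R = "\<lambda>p q. coprime p (content_int q)"
  have "D_mult \<Psi> = {X :: real^'n^'m. X \<in> unit_cube \<and> infinite {(p, q). mult_solution \<Psi> X p q \<and> (\<forall>i. ?R (p $ i) q)}}"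
    by (simp only: D_mult_def Gcd_insert_range_eq_1_iff)
  moreover have "negligible (often_mult ?R \<Psi> :: (real^'n^'m) set) \<or>
      negligible (- (often_mult ?R \<Psi> :: (real^'n^'m) set))"
    by (rule often_mult_zero_one, rule zero_one_linear_form_coprime) auto
  ultimately have "(D_mult \<Psi> :: (real^'n^'m) set) \<in> sets lebesgue \<and>
      (emeasure lebesgue (D_mult \<Psi> :: (real^'n^'m) set) = 0 \<or> emeasure lebesgue (D_mult \<Psi> :: (real^'n^'m) set) = 1)"
    using often_mult_unit_cube[of ?R \<Psi>] by simp
  with S show ?thesis by blast
qed

end
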